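(* For $1\le p\le 2$, $S_p(\mathbb R)\subseteq \mathcal F_p$, where $$\mathcal F_p=\Bigl\{\Lambda\in L^\infty(\mathbb R):\ \text{for a.e. } x\in[0,1),\ \Lambda_x^\#\in M_p(\mathbb T),\ \text{and the function } x\mapsto\|\Lambda_x^\#\|_{M_p(\mathbb T)} \text{ belongs to } L^\infty[0,1)\Bigr\}.$$
   Context: For $1\le p<\infty$, $M_p(\mathbb R)$ denotes the space of Fourier multipliers for $L^p(\mathbb R)$, i.e. functions $m\in L^\infty(\mathbb R)$ (modulo null sets) such that $f\mapsto (m\hat f)^\vee$ extends to a bounded operator on $L^p(\mathbb R)$, with the operator norm; $M_p(\mathbb Z)$ denotes the space of Fourier multipliers (bounded sequences on $\mathbb Z$) for $L^p(\mathbb T)$, with the operator norm; $M_p(\mathbb T)$ denotes the space of Fourier multipliers (1-periodic bounded measurable functions) for $\ell_p(\mathbb Z)$, with the operator norm. Here $\mathbb T$ is identified with $[0,1)$, and $\hat f(\xi)=\int_{\mathbb R}f(x)e^{-2\pi i\xi x}\,dx$. $S_p(\mathbb R)$ (summability kernels for $L^p(\mathbb R)$ multipliers) is the set of measurable functions $\Lambda$ on $\mathbb R$ such that for each $\phi\in M_p(\mathbb Z)$ the series $W_{\phi,\Lambda}(\xi)=\sum_{n\in\mathbb Z}\phi(n)\Lambda(\xi-n)$ converges a.e., belongs to $M_p(\mathbb R)$, and there is a constant $C_{p,\Lambda}$ (independent of $\phi$) with $\|W_{\phi,\Lambda}\|_{M_p(\mathbb R)}\le C_{p,\Lambda}\|\phi\|_{M_p(\mathbb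 Z)}$. Series over $\mathbb Z$ are limits of the symmetric partial sums over $|n|\le N$. For $x\in\mathbb R$, $\Lambda_x(\xi)=e^{2\pi i x\xi}\Lambda(\xi)$, and $\Lambda_x^\#$ is its 1-periodization $\Lambda_x^\#(\xi)=\sum_{n\in\mathbb Z}\Lambda_x(\xi+n)$; the condition $\Lambda_x^\#\in M_p(\mathbb T)$ includes that this series converges for a.e. $\xi$. *)

theory Defs
  imports "HOL-Analysis.Analysis"
begin

text \<open>Lebesgue spaces of complex functions. Elements are represented by functions; functions
  that agree almost everywhere are not identified, so all notions below are insensitive to
  changes on null sets. The circle is \<^term>\<open>{0..<1::real}\<close> with Lebesgue measure, and the
  sequence space over the integers is the case of the counting measure.\<close>

definition Lp :: "real \<Rightarrow> 'a measure \<Rightarrow> ('a \<Rightarrow> complex) set" where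
  "Lp p M = {f \<in> borel_measurable M. integrable M (\<lambda>x. cmod (f x) powr p)}"

definition Lp_norm :: "real \<Rightarrow> 'a measure \<Rightarrow> ('a \<Rightarrow> complex) \<Rightarrow> real" where
  "Lp_norm p M f = (\<integral>x. cmod (f x) powr p \<partial>M) powr (1 / p)"

definition Linfty :: "'a measure \<Rightarrow> ('a \<Rightarrow> 'b::real_normed_vector) set" where
  "Linfty M = {f \<in> borel_measurable M. \<exists>B. AE x in M. norm (f x) \<le> B}"

text \<open>\<open>T\<close>, given on the dense subspace \<open>D\<close>, extends to a linear operator \<open>S\<close> on \<open>Lp p M\<close> with
  \<open>\<parallel>S\<parallel> \<le> C\<close>. Linearity is modulo null sets; together with the bound it implies that \<open>S\<close>
  respects equality almost everywhere. As \<open>D\<close> is dense, \<open>S\<close> is unique up to null sets, so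
  the infimum of the admissible \<open>C\<close> is the operator norm of the extension.\<close>

definition extends_with_bound ::
  "real \<Rightarrow> 'a measure \<Rightarrow> ('a \<Rightarrow> complex) set \<Rightarrow> (('a \<Rightarrow> complex) \<Rightarrow> 'a \<Rightarrow> complex) \<Rightarrow> real \<Rightarrow> bool" where
  "extends_with_bound p M D T C \<longleftrightarrow> 0 \<le> C \<and>
    (\<exists>S. (\<forall>f\<in>Lp p M. S f \<in> Lp p M \<and> Lp_norm p M (S f) \<le> C * Lp_norm p M f) \<and>
         (\<forall>f\<in>Lp p M. \<forall>g\<in>Lp p M. AE x in M. S (\<lambda>y. f y + g y) x = S f x + S g x) \<and>
         (\<forall>c. \<forall>f\<in>Lp p M. AE x in M. S (\<lambda>y. c * f y) x = c * S f x) \<and>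
         (\<forall>f\<in>D. AE x in M. S f x = T f x))"

definition extension_norm ::
  "real \<Rightarrow> 'a measure \<Rightarrow> ('a \<Rightarrow> complex) set \<Rightarrow> (('a \<Rightarrow> complex) \<Rightarrow> 'a \<Rightarrow> complex) \<Rightarrow> real" where
  "extension_norm p M D T = Inf {C. extends_with_bound p M D T C}"

text \<open>In \<open>schwartz\<close>, \<open>D n\<close> is the \<open>n\<close>-th derivative of \<open>f\<close>.\<close>

definition schwartz :: "(real \<Rightarrow> complex) set" where
  "schwartz = {f. \<exists>D. D 0 = f \<and>
     (\<forall>n x. (D n has_vector_derivative D (Suc n) x) (at x)) \<and>
     (\<forall>n k. bounded (range (\<lambda>x. (x ^ k) *\<^sub>R D n x)))}"

definition fourier_R :: "(real \<Rightarrow> complex) \<Rightarrow> real \<Rightarrow> complex" where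
  "fourier_R f \<xi> = (\<integral>x. f x * cis (- (2 * pi * \<xi> * x)) \<partial>lebesgue)"

definition inv_fourier_R :: "(real \<Rightarrow> complex) \<Rightarrow> real \<Rightarrow> complex" where
  "inv_fourier_R g x = (\<integral>\<xi>. g \<xi> * cis (2 * pi * \<xi> * x) \<partial>lebesgue)"

definition mult_op_R :: "(real \<Rightarrow> complex) \<Rightarrow> (real \<Rightarrow> complex) \<Rightarrow> real \<Rightarrow> complex" where
  "mult_op_R m f = inv_fourier_R (\<lambda>\<xi>. m \<xi> * fourier_R f \<xi>)"

definition M_R :: "real \<Rightarrow> (real \<Rightarrow> complex) set" where
  "M_R p = {m \<in> Linfty lebesgue. \<exists>C. extends_with_bound p lebesgue schwartz (mult_op_R m) C}"

definition norm_M_R :: "real \<Rightarrow> (real \<Rightarrow> complex) \<Rightarrow> real" where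
  "norm_M_R p m = extension_norm p lebesgue schwartz (mult_op_R m)"

definition trig_polys :: "(real \<Rightarrow> complex) set" where
  "trig_polys = {f. \<exists>c F. finite F \<and> f = (\<lambda>x. \<Sum>n\<in>F. c n * cis (2 * pi * of_int n * x))}"

definition fourier_T :: "(real \<Rightarrow> complex) \<Rightarrow> int \<Rightarrow> complex" where
  "fourier_T f n = (\<integral>x. f x * cis (- (2 * pi * of_int n * x)) \<partial>lebesgue_on {0..<1})"

text \<open>The sum below is finite for trigonometric polynomials \<open>f\<close>.\<close>

definition mult_op_T :: "(int \<Rightarrow> complex) \<Rightarrow> (real \<Rightarrow> complex) \<Rightarrow> real \<Rightarrow> complex" where
  "mult_op_T \<phi> f x = (\<Sum>\<^sub>\<infinity>n. \<phi> n * fourier_T f n * cis (2 * pi * of_int n * x))"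

definition M_Z :: "real \<Rightarrow> (int \<Rightarrow> complex) set" where
  "M_Z p = {\<phi>. bounded (range \<phi>) \<and>
     (\<exists>C. extends_with_bound p (lebesgue_on {0..<1}) trig_polys (mult_op_T \<phi>) C)}"

definition norm_M_Z :: "real \<Rightarrow> (int \<Rightarrow> complex) \<Rightarrow> real" where
  "norm_M_Z p \<phi> = extension_norm p (lebesgue_on {0..<1}) trig_polys (mult_op_T \<phi>)"

definition finite_seqs :: "(int \<Rightarrow> complex) set" where
  "finite_seqs = {a. finite {k. a k \<noteq> 0}}"

definition fourier_Z :: "(int \<Rightarrow> complex) \<Rightarrow> real \<Rightarrow> complex" where
  "fourier_Z a \<xi> = (\<Sum>\<^sub>\<infinity>k. a k * cis (- (2 * pi * of_int k * \<xi>)))"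

definition mult_op_Z :: "(real \<Rightarrow> complex) \<Rightarrow> (int \<Rightarrow> complex) \<Rightarrow> int \<Rightarrow> complex" where
  "mult_op_Z m a k =
     (\<integral>\<xi>. m \<xi> * fourier_Z a \<xi> * cis (2 * pi * of_int k * \<xi>) \<partial>lebesgue_on {0..<1})"

text \<open>Periodicity and boundedness are required almost everywhere, as multipliers are taken
  modulo null sets.\<close>

definition M_T :: "real \<Rightarrow> (real \<Rightarrow> complex) set" where
  "M_T p = {m \<in> Linfty lebesgue. (AE \<xi> in lebesgue. m (\<xi> + 1) = m \<xi>) \<and>
     (\<exists>C. extends_with_bound p (count_space UNIV) finite_seqs (mult_op_Z m) C)}"

definition norm_M_T :: "real \<Rightarrow> (real \<Rightarrow> complex) \<Rightarrow> real" where
  "norm_M_T p m = extension_norm p (count_space UNIV) finite_seqs (mult_op_Z m)"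

text \<open>Two-sided series are limits of symmetric partial sums. \<^const>\<open>lim\<close> is arbitrary where the
  limit does not exist, so convergence is always stated separately.\<close>

definition symm_sum :: "(int \<Rightarrow> complex) \<Rightarrow> nat \<Rightarrow> complex" where
  "symm_sum a N = (\<Sum>n = - int N..int N. a n)"

definition W :: "(int \<Rightarrow> complex) \<Rightarrow> (real \<Rightarrow> complex) \<Rightarrow> real \<Rightarrow> complex" where
  "W \<phi> \<Lambda> \<xi> = lim (symm_sum (\<lambda>n. \<phi> n * \<Lambda> (\<xi> - of_int n)))"

definition summability_kernels :: "real \<Rightarrow> (real \<Rightarrow> complex) set" where
  "summability_kernels p = {\<Lambda> \<in> borel_measurable lebesgue.
     (\<forall>\<phi>\<in>M_Z p. (AE \<xi> in lebesgue. convergent (symm_sum (\<lambda>n. \<phi> n * \<Lambda> (\<xi> - of_int n)))) \<and>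
        W \<phi> \<Lambda> \<in> M_R p) \<and>
     (\<exists>C. \<forall>\<phi>\<in>M_Z p. norm_M_R p (W \<phi> \<Lambda>) \<le> C * norm_M_Z p \<phi>)}"

definition modulate :: "real \<Rightarrow> (real \<Rightarrow> complex) \<Rightarrow> real \<Rightarrow> complex" where
  "modulate x \<Lambda> \<xi> = cis (2 * pi * x * \<xi>) * \<Lambda> \<xi>"

definition periodization :: "(real \<Rightarrow> complex) \<Rightarrow> real \<Rightarrow> complex" where
  "periodization g \<xi> = lim (symm_sum (\<lambda>n. g (\<xi> + of_int n)))"

definition F_class :: "real \<Rightarrow> (real \<Rightarrow> complex) set" where
  "F_class p = {\<Lambda> \<in> Linfty lebesgue.
     (AE x in lebesgue_on {0..<1}.
        (AE \<xi> in lebesgue. convergent (symm_sum (\<lambda>n. modulate x \<Lambda> (\<xi> + of_int n)))) \<and>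
        periodization (modulate x \<Lambda>) \<in> M_T p) \<and>
     (\<lambda>x. norm_M_T p (periodization (modulate x \<Lambda>))) \<in> Linfty (lebesgue_on {0..<1})}"

end

theory Submission
  imports Defs "HOL-Probability.Sinc_Integral"
begin

text \<open>The characters \<open>n \<mapsto> cis (- (2 * pi * x * n))\<close> act on the circle as rotations, so they are
  multipliers of norm at most 1, and for them \<open>W\<close> is the periodization of \<open>\<Lambda>\<^sub>x\<close> up to the factor
  \<open>cis (2 * pi * x * \<xi>)\<close>, which is a translation on the physical side. Hence the periodizations are
  multipliers on the line with a bound that does not depend on \<open>x\<close>. For a 1-periodic \<open>m\<close> and a
  bump \<open>b\<close> supported in the unit interval, Poisson summation shows that the operator of \<open>m\<close>
  sends \<open>\<Sum>j. a j * b (t - j)\<close> to \<open>\<Sum>k. (T a) k * b (t - k)\<close>, where \<open>T\<close> is the operator of \<open>m\<close> on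
  sequences; as the translates of \<open>b\<close> have disjoint supports, the bound passes to \<open>T\<close>.
  Boundedness of \<open>\<Lambda>\<close> comes from the multiplier \<open>\<delta>\<^sub>0\<close>. The norm is measurable in \<open>x\<close> because each
  inequality \<open>norm \<le> b\<close> is equivalent to countably many inequalities between Fourier
  coefficients, which are measurable in \<open>x\<close> by Fubini.\<close>

section \<open>Convolution operators on sequences\<close>

text \<open>Two obstacles shape the proof. The first is that a multiplier norm is an infimum over
  constants for which some linear extension to a whole Lp space exists. On the sequence side this is
  bypassed: a circle multiplier acts on finitely supported sequences as convolution with its Fourier
  coefficients, and a constant is admissible exactly when it satisfies a family of inequalities
  between finite sums (\<open>conv_bound\<close>). Such inequalities pass to limits, so the infimum
  is attained. The second is that periodicity of a periodization is not automatic: shifting \<xi> by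
  1 changes each symmetric partial sum by two boundary terms. They disappear because \<Lambda>(\<xi>
  + N) and \<Lambda>(\<xi> - N) tend to 0 for almost every \<xi>, which is extracted from the
  convergence of the kernel series for two characters. On the line the operator is prescribed only
  on Schwartz functions. The bump must therefore be smooth, and the quadratic decay of its transform
  justifies exchanging sums over integer translates with integrals.\<close>

lemma count_space_integral_le:
  fixes g :: "'a \<Rightarrow> real"
  assumes g0: "\<And>i. 0 \<le> g i" and bound: "\<And>K. finite K \<Longrightarrow> sum g K \<le> B"
  shows "integrable (count_space UNIV) g" "integral\<^sup>L (count_space UNIV) g \<le> B"
proof -
  have "g summable_on UNIV"
    by (rule nonneg_bdd_above_summable_on) (use assms in \<open>auto intro!: bdd_aboveI\<close>)
  moreover from this have "(\<lambda>x. norm (g x)) summable_on UNIV" using g0 by simp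
  ultimately show *: "integrable (count_space UNIV) g"
    using abs_summable_equivalent[of g UNIV] by (simp add: abs_summable_on_def)
  have "infsum g UNIV \<le> B"
    by (rule infsum_le_finite_sums) (use assms \<open>g summable_on UNIV\<close> in auto)
  moreover have "infsetsum g UNIV = infsum g UNIV"
    by (rule infsetsum_infsum) (use * in \<open>simp add: abs_summable_on_def\<close>)
  ultimately show "integral\<^sup>L (count_space UNIV) g \<le> B"
    by (simp add: infsetsum_def)
qed

lemma sum_le_count_space_integral:
  fixes g :: "'a \<Rightarrow> real"
  assumes g0: "\<And>i. 0 \<le> g i" and int: "integrable (count_space UNIV) g" and "finite K"
  shows "sum g K \<le> integral\<^sup>L (count_space UNIV) g"
proof -
  have "Infinite_Set_Sum.abs_summable_on g UNIV"
    using int by (simp add: Infinite_Set_Sum.abs_summable_on_def)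
  then have s: "g summable_on UNIV" and eq: "infsetsum g UNIV = infsum g UNIV"
    using abs_summable_equivalent abs_summable_summable infsetsum_infsum by blast+
  have "sum g K \<le> infsum g UNIV"
    by (rule finite_sum_le_infsum) (use s assms in auto)
  then show ?thesis
    using eq by (simp add: infsetsum_def)
qed

text \<open>The sum runs over the support of \<open>a\<close>, so it is a genuine finite sum exactly
  for the sequences in \<open>finite_seqs\<close>; no summability of \<open>c\<close> is
  required.\<close>

definition conv_seq :: "(int \<Rightarrow> complex) \<Rightarrow> (int \<Rightarrow> complex) \<Rightarrow> int \<Rightarrow> complex" where
  "conv_seq c a k = (\<Sum>j | a j \<noteq> 0. a j * c (k - j))"

text \<open>Finite \<open>K\<close> and p-th powers keep integrals, roots and extension operators
  out of the condition. Nonnegativity of \<open>C\<close> is not included and is stated separately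
  where it matters.\<close>

definition conv_bound :: "real \<Rightarrow> (int \<Rightarrow> complex) \<Rightarrow> real \<Rightarrow> bool" where
  "conv_bound p c C \<longleftrightarrow> (\<forall>a\<in>finite_seqs. \<forall>K. finite K \<longrightarrow>
     (\<Sum>k\<in>K. cmod (conv_seq c a k) powr p) \<le> C powr p * (\<Sum>j | a j \<noteq> 0. cmod (a j) powr p))"

lemma conv_seq_superset:
  assumes "finite F" "{j. a j \<noteq> 0} \<subseteq> F"
  shows "conv_seq c a k = (\<Sum>j\<in>F. a j * c (k - j))"
  unfolding conv_seq_def by (rule sum.mono_neutral_left) (use assms in auto)

lemma powr_sum_superset:
  assumes "finite F" "{j. a j \<noteq> 0} \<subseteq> F"
  shows "(\<Sum>j | a j \<noteq> 0. cmod (a j) powr p) = (\<Sum>j\<in>F. cmod (a j) powr p)"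
  by (rule sum.mono_neutral_left) (use assms in auto)

lemma powr_inverse_le_iff:
  fixes p :: real
  assumes "0 < p" "0 \<le> A" "0 \<le> B" "0 \<le> C"
  shows "A powr (1/p) \<le> C * B powr (1/p) \<longleftrightarrow> A \<le> C powr p * B"
proof -
  have eq: "(C powr p * B) powr (1/p) = C * B powr (1/p)"
    using assms by (simp add: powr_mult powr_powr)
  show ?thesis
    unfolding eq[symmetric] using assms
    by (meson divide_pos_pos mult_nonneg_nonneg not_le order_less_imp_le powr_ge_zero powr_less_mono2 powr_mono2 zero_less_one)
qed

text \<open>Null sets of the counting measure are empty, so the extension agrees with
  \<open>conv_seq c\<close> at every index, and a finite partial sum of its p-th powers is at most
  the full integral.\<close>

lemma extends_with_bound_conv_imp:
  assumes p: "1 \<le> p" and ext: "extends_with_bound p (count_space UNIV) finite_seqs (conv_seq c) C"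
  shows "conv_bound p c C"
  unfolding conv_bound_def
proof (intro ballI allI impI)
  fix a :: "int \<Rightarrow> complex" and K :: "int set"
  assume a: "a \<in> finite_seqs" and K: "finite K"
  let ?F = "{j. a j \<noteq> 0}" and ?M = "count_space (UNIV :: int set)"
  have fin: "finite ?F" using a by (simp add: finite_seqs_def)
  obtain S where C: "0 \<le> C"
    and S: "\<And>f. f \<in> Lp p ?M \<Longrightarrow> S f \<in> Lp p ?M \<and> Lp_norm p ?M (S f) \<le> C * Lp_norm p ?M f"
    and Sa: "\<And>f k. f \<in> finite_seqs \<Longrightarrow> S f k = conv_seq c f k"
    using ext unfolding extends_with_bound_def AE_count_space by (metis UNIV_I)
  have bnd: "(\<Sum>j\<in>L. cmod (a j) powr p) \<le> (\<Sum>j\<in>?F. cmod (a j) powr p)" if "finite L" for L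
  proof -
    have "(\<Sum>j\<in>L. cmod (a j) powr p) \<le> (\<Sum>j\<in>L \<union> ?F. cmod (a j) powr p)"
      by (rule sum_mono2) (use that fin in auto)
    also have "\<dots> = (\<Sum>j\<in>?F. cmod (a j) powr p)"
      by (rule powr_sum_superset[symmetric]) (use that fin in auto)
    finally show ?thesis .
  qed
  have aL: "a \<in> Lp p ?M" and int_a: "(\<integral>j. cmod (a j) powr p \<partial>?M) \<le> (\<Sum>j\<in>?F. cmod (a j) powr p)"
    using count_space_integral_le[of "\<lambda>j. cmod (a j) powr p" "\<Sum>j\<in>?F. cmod (a j) powr p"] bnd
    by (auto simp: Lp_def)
  have Sint: "integrable ?M (\<lambda>k. cmod (S a k) powr p)" using S[OF aL] by (simp add: Lp_def)
  have "(\<Sum>k\<in>K. cmod (conv_seq c a k) powr p) = (\<Sum>k\<in>K. cmod (S a k) powr p)"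
    using Sa[OF a] by simp
  also have "\<dots> \<le> (\<integral>k. cmod (S a k) powr p \<partial>?M)"
    by (rule sum_le_count_space_integral[OF _ Sint K]) auto
  also have "\<dots> \<le> C powr p * (\<integral>j. cmod (a j) powr p \<partial>?M)"
    using S[OF aL] powr_inverse_le_iff[of p] p C unfolding Lp_norm_def by auto
  also have "\<dots> \<le> C powr p * (\<Sum>j\<in>?F. cmod (a j) powr p)"
    by (rule mult_left_mono[OF int_a]) auto
  finally show "(\<Sum>k\<in>K. cmod (conv_seq c a k) powr p) \<le> C powr p * (\<Sum>j\<in>?F. cmod (a j) powr p)" .
qed

lemma cmod_powr_tendsto:
  assumes "1 \<le> (p::real)" "(f \<longlongrightarrow> l) F"
  shows "((\<lambda>n. cmod (f n) powr p) \<longlongrightarrow> cmod l powr p) F"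
  by (rule tendsto_powr2) (use assms in \<open>auto intro!: tendsto_intros\<close>)

text \<open>Density is made explicit: the extension is the pointwise limit of the convolutions of
  symmetric truncations. Existence of the limit and the bound both come from \<open>trunc\<close>,
  the inequality for a sequence cut off to a finite set, so \<open>C\<close> is preserved
  exactly.\<close>

lemma conv_bound_imp_extends:
  assumes p: "1 \<le> p" and C: "0 \<le> C" and cb: "conv_bound p c C"
  shows "extends_with_bound p (count_space UNIV) finite_seqs (conv_seq c) C"
proof -
  let ?M = "count_space (UNIV :: int set)"
  define I where "I N = {- int N..int N}" for N
  define S where "S f k = lim (\<lambda>N. \<Sum>j\<in>I N. f j * c (k - j))" for f k
  have trunc: "(\<Sum>k\<in>K. cmod (\<Sum>j\<in>J. f j * c (k - j)) powr p) \<le> C powr p * (\<Sum>j\<in>J. cmod (f j) powr p)"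
    if "finite J" "finite K" for f J K
  proof -
    define a where "a j = (if j \<in> J then f j else 0)" for j
    have sub: "{j. a j \<noteq> 0} \<subseteq> J" by (auto simp: a_def)
    then have "a \<in> finite_seqs" using that finite_subset by (auto simp: finite_seqs_def)
    then have "(\<Sum>k\<in>K. cmod (conv_seq c a k) powr p) \<le> C powr p * (\<Sum>j | a j \<noteq> 0. cmod (a j) powr p)"
      using cb that by (simp add: conv_bound_def)
    then show ?thesis
      unfolding conv_seq_superset[OF that(1) sub] powr_sum_superset[OF that(1) sub] by (simp add: a_def)
  qed
  have conv: "(\<lambda>N. \<Sum>j\<in>I N. f j * c (k - j)) \<longlonglongrightarrow> S f k" if f: "f \<in> Lp p ?M" for f k
  proof -
    define s where "s N = (\<Sum>j\<in>I N. cmod (f j) powr p)" for N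
    let ?t = "\<lambda>N. \<Sum>j\<in>I N. f j * c (k - j)"
    have fint: "integrable ?M (\<lambda>j. cmod (f j) powr p)" using f by (simp add: Lp_def)
    have "incseq s" unfolding s_def I_def by (rule incseq_SucI) (rule sum_mono2, auto)
    moreover have "s N \<le> (\<integral>j. cmod (f j) powr p \<partial>?M)" for N
      unfolding s_def by (rule sum_le_count_space_integral[OF _ fint]) (auto simp: I_def)
    ultimately have "convergent s" using incseq_convergent[of s] by (metis convergent_def)
    then have cau: "Cauchy s" by (simp add: Cauchy_convergent_iff)
    \<comment> \<open>The difference of two truncated sums is the convolution of the block between
      them; taking \<open>K\<close> to be the single index \<open>k\<close> bounds it by the p-th
      power mass of that block.\<close>
    have diff: "cmod (?t N - ?t M) powr p \<le> C powr p * (s N - s M)" if "M \<le> N" for M N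
    proof -
      have sub: "I M \<subseteq> I N" "finite (I N)" using that by (auto simp: I_def)
      have "?t N - ?t M = (\<Sum>j\<in>I N - I M. f j * c (k - j))" "s N - s M = (\<Sum>j\<in>I N - I M. cmod (f j) powr p)"
        unfolding s_def using sub by (auto simp: sum_diff)
      then show ?thesis using trunc[of "I N - I M" "{k}" f] sub by simp
    qed
    have "Cauchy ?t"
    proof (rule metric_CauchyI)
      fix e :: real assume e: "0 < e"
      \<comment> \<open>The summand 1 keeps the denominator positive when C = 0.\<close>
      define d where "d = e powr p / (C powr p + 1)"
      have Cp: "C powr p + 1 > 0" using powr_ge_zero[of C p] by linarith
      have "d > 0" unfolding d_def using e Cp by simp
      then obtain M where M: "\<And>m n. m \<ge> M \<Longrightarrow> n \<ge> M \<Longrightarrow> dist (s m) (s n) < d"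
        using cau unfolding Cauchy_def by meson
      have main: "dist (?t n) (?t m) < e" if mn: "M \<le> m" "m \<le> n" for m n
      proof -
        have "cmod (?t n - ?t m) powr p \<le> C powr p * (s n - s m)" using diff mn by simp
        also have "\<dots> \<le> C powr p * d"
          using M[of n m] mn by (intro mult_left_mono) (auto simp: dist_real_def)
        also have "\<dots> < (C powr p + 1) * d" using \<open>d > 0\<close> by simp
        also have "\<dots> = e powr p" using Cp by (simp add: d_def)
        finally have "cmod (?t n - ?t m) < e"
          using powr_mono2[of p e "cmod (?t n - ?t m)"] e p by (meson less_le_not_le linorder_le_less_linear norm_ge_zero order_trans zero_le_one)
        then show ?thesis by (simp add: dist_norm)
      qed
      show "\<exists>M. \<forall>m\<ge>M. \<forall>n\<ge>M. dist (?t m) (?t n) < e"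
        using main by (metis dist_commute nle_le)
    qed
    then show ?thesis unfolding S_def by (simp add: Cauchy_convergent_iff convergent_LIMSEQ_iff)
  qed
  have bound: "integrable ?M (\<lambda>k. cmod (S f k) powr p)"
    "(\<integral>k. cmod (S f k) powr p \<partial>?M) \<le> C powr p * (\<integral>j. cmod (f j) powr p \<partial>?M)" if f: "f \<in> Lp p ?M" for f
  proof -
    have fint: "integrable ?M (\<lambda>j. cmod (f j) powr p)" using f by (simp add: Lp_def)
    have "(\<Sum>k\<in>K. cmod (S f k) powr p) \<le> C powr p * (\<integral>j. cmod (f j) powr p \<partial>?M)" if K: "finite K" for K
    proof (rule tendsto_upperbound)
      show "(\<lambda>N. \<Sum>k\<in>K. cmod (\<Sum>j\<in>I N. f j * c (k - j)) powr p) \<longlonglongrightarrow> (\<Sum>k\<in>K. cmod (S f k) powr p)"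
        using conv[OF f] p by (intro tendsto_sum cmod_powr_tendsto) auto
      have "(\<Sum>k\<in>K. cmod (\<Sum>j\<in>I N. f j * c (k - j)) powr p) \<le> C powr p * (\<integral>j. cmod (f j) powr p \<partial>?M)" for N
      proof -
        have fI: "finite (I N)" by (simp add: I_def)
        show ?thesis
          using trunc[OF fI K, of f] sum_le_count_space_integral[OF _ fint fI]
          by (smt (verit) mult_left_mono powr_ge_zero)
      qed
      then show "\<forall>\<^sub>F N in sequentially. (\<Sum>k\<in>K. cmod (\<Sum>j\<in>I N. f j * c (k - j)) powr p) \<le> C powr p * (\<integral>j. cmod (f j) powr p \<partial>?M)"
        by simp
    qed auto
    then show "integrable ?M (\<lambda>k. cmod (S f k) powr p)"
      "(\<integral>k. cmod (S f k) powr p \<partial>?M) \<le> C powr p * (\<integral>j. cmod (f j) powr p \<partial>?M)"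
      using count_space_integral_le[of "\<lambda>k. cmod (S f k) powr p"] by auto
  qed
  have S1: "S f \<in> Lp p ?M \<and> Lp_norm p ?M (S f) \<le> C * Lp_norm p ?M f" if f: "f \<in> Lp p ?M" for f
    using bound[OF f] powr_inverse_le_iff[of p] p C by (auto simp: Lp_def Lp_norm_def)
  have S2: "S (\<lambda>y. f y + g y) x = S f x + S g x" if "f \<in> Lp p ?M" "g \<in> Lp p ?M" for f g x
  proof -
    have "(\<lambda>N. \<Sum>j\<in>I N. (f j + g j) * c (x - j)) \<longlonglongrightarrow> S f x + S g x"
      using tendsto_add[OF conv[OF that(1), of x] conv[OF that(2), of x]]
      by (simp add: algebra_simps sum.distrib)
    then show ?thesis unfolding S_def[of "\<lambda>y. f y + g y"] by (rule limI)
  qed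
  have S3: "S (\<lambda>y. b * f y) x = b * S f x" if "f \<in> Lp p ?M" for b f x
  proof -
    have "(\<lambda>N. \<Sum>j\<in>I N. (b * f j) * c (x - j)) \<longlonglongrightarrow> b * S f x"
      using tendsto_mult_left[OF conv[OF that(1), of x], of b]
      by (simp add: sum_distrib_left mult.assoc)
    then show ?thesis unfolding S_def[of "\<lambda>y. b * f y"] by (rule limI)
  qed
  have S4: "S a k = conv_seq c a k" if a: "a \<in> finite_seqs" for a k
  proof -
    have fin: "finite {j. a j \<noteq> 0}" using a by (simp add: finite_seqs_def)
    \<comment> \<open>For a = 0 this is the maximum of an empty set, an arbitrary value, but then
      the support lies in every \<open>I N\<close> anyway.\<close>
    define B where "B = Max (abs ` {j. a j \<noteq> 0})"
    have "\<bar>j\<bar> \<le> B" if "a j \<noteq> 0" for j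
      unfolding B_def using fin that by (intro Max_ge) auto
    then have "{j. a j \<noteq> 0} \<subseteq> I N" if "nat B \<le> N" for N
      using that unfolding I_def by (force simp: nat_le_iff)
    then have "\<forall>\<^sub>F N in sequentially. (\<Sum>j\<in>I N. a j * c (k - j)) = conv_seq c a k"
      by (intro eventually_sequentiallyI[of "nat B"] conv_seq_superset[symmetric]) (auto simp: I_def)
    then have "(\<lambda>N. \<Sum>j\<in>I N. a j * c (k - j)) \<longlonglongrightarrow> conv_seq c a k"
      by (rule tendsto_eventually)
    then show ?thesis unfolding S_def by (rule limI)
  qed
  show ?thesis
    unfolding extends_with_bound_def
    by (intro conjI C exI[of _ S]) (use S1 S2 S3 S4 in \<open>auto simp: AE_count_space\<close>)
qed

lemma extends_with_bound_conv_iff: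
  assumes "1 \<le> p"
  shows "extends_with_bound p (count_space UNIV) finite_seqs (conv_seq c) C \<longleftrightarrow> 0 \<le> C \<and> conv_bound p c C"
  using assms extends_with_bound_conv_imp conv_bound_imp_extends
  by (metis extends_with_bound_def)

section \<open>Measurable dependence of the operator norm\<close>

text \<open>The approximants live on the support of their limit, so in every later sum the index set
  can be fixed and coordinatewise convergence suffices.\<close>

lemma countable_dense_finite_seqs:
  obtains A where "countable A" "A \<subseteq> finite_seqs"
    "\<And>a. a \<in> finite_seqs \<Longrightarrow> \<exists>s. (\<forall>n::nat. s n \<in> A \<and> {j. s n j \<noteq> 0} \<subseteq> {j. a j \<noteq> 0}) \<and> (\<forall>j. (\<lambda>n. s n j) \<longlonglongrightarrow> a j)"
proof -
  obtain D :: "complex set" where D: "countable D" "\<And>X. open X \<Longrightarrow> X \<noteq> {} \<Longrightarrow> \<exists>d\<in>D. d \<in> X"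
    by (erule countable_dense_setE)
  define ext where "ext F g j = (if j \<in> F then g j else 0)" for F :: "int set" and g :: "int \<Rightarrow> complex" and j
  define A where "A = (\<Union>F\<in>Collect finite. ext F ` PiE F (\<lambda>_. D))"
  have ext_nz: "{j. ext F g j \<noteq> 0} \<subseteq> F" for F g by (auto simp: ext_def)
  have "countable A"
    unfolding A_def using D(1)
    by (intro countable_UN countable_Collect_finite countable_image countable_PiE) auto
  moreover have "A \<subseteq> finite_seqs"
    unfolding A_def finite_seqs_def using ext_nz by (auto intro: finite_subset)
  moreover have "\<exists>s. (\<forall>n::nat. s n \<in> A \<and> {j. s n j \<noteq> 0} \<subseteq> {j. a j \<noteq> 0}) \<and> (\<forall>j. (\<lambda>n. s n j) \<longlonglongrightarrow> a j)"
    if a: "a \<in> finite_seqs" for a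
  proof -
    let ?F = "{j. a j \<noteq> 0}"
    have F: "finite ?F" using a by (simp add: finite_seqs_def)
    have "\<exists>d\<in>D. d \<in> ball (a j) (inverse (real (Suc n)))" for j n
      by (rule D(2)) (auto simp: ball_eq_empty simp del: of_nat_Suc)
    then obtain d where d: "\<And>j n. d j n \<in> D" "\<And>j n. d j n \<in> ball (a j) (inverse (real (Suc n)))"
      by metis
    have lim: "(\<lambda>n. d j n) \<longlonglongrightarrow> a j" for j
    proof -
      have "(\<lambda>n. dist (d j n) (a j)) \<longlonglongrightarrow> 0"
        by (rule tendsto_sandwich[OF _ _ tendsto_const LIMSEQ_inverse_real_of_nat])
           (use d(2) in \<open>auto intro!: always_eventually simp: dist_commute less_imp_le simp del: of_nat_Suc\<close>)
      then show ?thesis by (rule iffD2[OF tendsto_dist_iff])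
    qed
    \<comment> \<open>Members of \<open>PiE\<close> are undefined off the index set, which is what
      makes \<open>PiE\<close> countable; \<open>restrict\<close> produces such a member and
      \<open>ext\<close> then replaces the undefined values by 0.\<close>
    define s where "s n = ext ?F (restrict (\<lambda>j. d j n) ?F)" for n
    have "s n \<in> A" for n
      unfolding A_def s_def using F d(1) by (intro UN_I[of ?F] imageI) auto
    moreover have "(\<lambda>n. s n j) \<longlonglongrightarrow> a j" for j
      using lim[of j] by (cases "a j = 0") (auto simp: s_def ext_def)
    ultimately show ?thesis
      using ext_nz[of ?F] by (intro exI[of _ s]) (auto simp: s_def)
  qed
  ultimately show ?thesis by (rule that)
qed

text \<open>For fixed \<open>K\<close> and a fixed finite support, both sides of the inequality are
  continuous in the finitely many entries of the sequence.\<close>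

lemma conv_bound_dense_iff:
  assumes p: "1 \<le> p"
    and A: "A \<subseteq> finite_seqs"
    and dense: "\<And>a. a \<in> finite_seqs \<Longrightarrow>
      \<exists>s. (\<forall>n::nat. s n \<in> A \<and> {j. s n j \<noteq> 0} \<subseteq> {j. a j \<noteq> 0}) \<and> (\<forall>j. (\<lambda>n. s n j) \<longlonglongrightarrow> a j)"
  shows "conv_bound p c C \<longleftrightarrow> (\<forall>a\<in>A. \<forall>K\<in>Collect finite.
     (\<Sum>k\<in>K. cmod (conv_seq c a k) powr p) \<le> C powr p * (\<Sum>j | a j \<noteq> 0. cmod (a j) powr p))"
    (is "_ \<longleftrightarrow> ?R")
proof
  assume "conv_bound p c C" then show ?R using A by (auto simp: conv_bound_def)
next
  assume R: ?R
  show "conv_bound p c C" unfolding conv_bound_def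
  proof (intro ballI allI impI)
    fix a :: "int \<Rightarrow> complex" and K :: "int set"
    assume a: "a \<in> finite_seqs" and K: "finite K"
    let ?F = "{j. a j \<noteq> 0}"
    have F: "finite ?F" using a by (simp add: finite_seqs_def)
    obtain s where s: "\<And>n. s n \<in> A" "\<And>n. {j. s n j \<noteq> 0} \<subseteq> ?F" "\<And>j. (\<lambda>n. s n j) \<longlonglongrightarrow> a j"
      using dense[OF a] by blast
    have "(\<Sum>k\<in>K. cmod (\<Sum>j\<in>?F. s n j * c (k - j)) powr p) \<le> C powr p * (\<Sum>j\<in>?F. cmod (s n j) powr p)" for n
    proof -
      have "(\<Sum>k\<in>K. cmod (conv_seq c (s n) k) powr p) \<le> C powr p * (\<Sum>j | s n j \<noteq> 0. cmod (s n j) powr p)"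
        using R s(1)[of n] K by blast
      then show ?thesis
        by (simp only: conv_seq_superset[OF F s(2)] powr_sum_superset[OF F s(2)])
    qed
    moreover have "(\<lambda>n. \<Sum>k\<in>K. cmod (\<Sum>j\<in>?F. s n j * c (k - j)) powr p) \<longlonglongrightarrow>
        (\<Sum>k\<in>K. cmod (\<Sum>j\<in>?F. a j * c (k - j)) powr p)"
      using p s(3) by (intro tendsto_sum cmod_powr_tendsto tendsto_mult tendsto_const) auto
    moreover have "(\<lambda>n. C powr p * (\<Sum>j\<in>?F. cmod (s n j) powr p)) \<longlonglongrightarrow> C powr p * (\<Sum>j\<in>?F. cmod (a j) powr p)"
      using p s(3) by (intro tendsto_sum cmod_powr_tendsto tendsto_mult tendsto_const) auto
    ultimately have "(\<Sum>k\<in>K. cmod (\<Sum>j\<in>?F. a j * c (k - j)) powr p) \<le> C powr p * (\<Sum>j\<in>?F. cmod (a j) powr p)"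
      by (intro LIMSEQ_le) auto
    then show "(\<Sum>k\<in>K. cmod (conv_seq c a k) powr p) \<le> C powr p * (\<Sum>j\<in>?F. cmod (a j) powr p)"
      by (simp add: conv_seq_def)
  qed
qed

lemma conv_bound_mono:
  assumes "1 \<le> p" "0 \<le> C" "C \<le> C'" "conv_bound p c C"
  shows "conv_bound p c C'"
  unfolding conv_bound_def
proof (intro ballI allI impI)
  fix a :: "int \<Rightarrow> complex" and K :: "int set"
  assume a: "a \<in> finite_seqs" and K: "finite K"
  have "(\<Sum>k\<in>K. cmod (conv_seq c a k) powr p) \<le> C powr p * (\<Sum>j | a j \<noteq> 0. cmod (a j) powr p)"
    using assms(4) a K by (simp add: conv_bound_def)
  also have "\<dots> \<le> C' powr p * (\<Sum>j | a j \<noteq> 0. cmod (a j) powr p)"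
    using assms by (intro mult_right_mono powr_mono2 sum_nonneg) auto
  finally show "(\<Sum>k\<in>K. cmod (conv_seq c a k) powr p) \<le> C' powr p * (\<Sum>j | a j \<noteq> 0. cmod (a j) powr p)" .
qed

text \<open>The infimum is attained: the inequalities hold for every constant above it and survive
  the limit from the right, by continuity of \<open>C powr p\<close>. A sublevel set of the norm is
  thus given by the inequalities at the single constant \<open>b\<close>. The bound \<open>K\<close>
  rules out the infimum of an empty set.\<close>

lemma Inf_conv_bound_le_iff:
  assumes p: "1 \<le> p" and K: "0 \<le> K" "conv_bound p c K"
  shows "Inf {C. 0 \<le> C \<and> conv_bound p c C} \<le> b \<longleftrightarrow> 0 \<le> b \<and> conv_bound p c b" (is "Inf ?S \<le> b \<longleftrightarrow> _")
proof
  have bdd: "bdd_below ?S" by (rule bdd_belowI[of _ 0]) auto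
  have ne: "?S \<noteq> {}" using K by blast
  assume le: "Inf ?S \<le> b"
  have b: "0 \<le> b" using cInf_greatest[OF ne, of 0] le by fastforce
  have cb: "conv_bound p c C'" if C': "b < C'" for C'
  proof -
    from cInf_lessD[OF ne, of C'] le C' obtain C where "C \<in> ?S" "C < C'" by auto
    then show ?thesis using conv_bound_mono[OF p, of C C' c] by simp
  qed
  have "conv_bound p c b"
    unfolding conv_bound_def
  proof (intro ballI allI impI)
    fix a :: "int \<Rightarrow> complex" and K :: "int set"
    assume a: "a \<in> finite_seqs" and K: "finite K"
    show "(\<Sum>k\<in>K. cmod (conv_seq c a k) powr p) \<le> b powr p * (\<Sum>j | a j \<noteq> 0. cmod (a j) powr p)"
    proof (rule tendsto_lowerbound)
      show "((\<lambda>C'. C' powr p * (\<Sum>j | a j \<noteq> 0. cmod (a j) powr p)) \<longlongrightarrow>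
          b powr p * (\<Sum>j | a j \<noteq> 0. cmod (a j) powr p)) (at_right b)"
        using p b by (intro tendsto_intros tendsto_powr2) (auto simp: eventually_at_filter)
      show "\<forall>\<^sub>F C' in at_right b. (\<Sum>k\<in>K. cmod (conv_seq c a k) powr p) \<le> C' powr p * (\<Sum>j | a j \<noteq> 0. cmod (a j) powr p)"
        using cb a K by (auto simp: eventually_at_filter conv_bound_def)
    qed auto
  qed
  with b show "0 \<le> b \<and> conv_bound p c b" by blast
next
  assume "0 \<le> b \<and> conv_bound p c b"
  then show "Inf ?S \<le> b" by (intro cInf_lower bdd_belowI[of _ 0]) auto
qed

lemma borel_measurable_Inf_conv_bound:
  assumes p: "1 \<le> p" and c[measurable]: "\<And>k. (\<lambda>x. c x k) \<in> borel_measurable M"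
    and K: "0 \<le> K" "\<And>x. x \<in> space M \<Longrightarrow> conv_bound p (c x) K"
  shows "(\<lambda>x. Inf {C. 0 \<le> C \<and> conv_bound p (c x) C}) \<in> borel_measurable M"
proof (subst borel_measurable_iff_le, intro allI)
  fix b :: real
  obtain A where A: "countable A" "A \<subseteq> finite_seqs"
    "\<And>a. a \<in> finite_seqs \<Longrightarrow> \<exists>s. (\<forall>n::nat. s n \<in> A \<and> {j. s n j \<noteq> 0} \<subseteq> {j. a j \<noteq> 0}) \<and> (\<forall>j. (\<lambda>n. s n j) \<longlonglongrightarrow> a j)"
    by (rule countable_dense_finite_seqs) blast
  have [measurable]: "countable (Collect (finite :: int set \<Rightarrow> bool))" by (rule countable_Collect_finite)
  note [measurable] = A(1)
  have [measurable]: "(\<lambda>x. \<Sum>k\<in>K. cmod (conv_seq (c x) a k) powr p) \<in> borel_measurable M" for a K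
    unfolding conv_seq_def by measurable
  have "{x \<in> space M. Inf {C. 0 \<le> C \<and> conv_bound p (c x) C} \<le> b} =
    {x \<in> space M. 0 \<le> b \<and> (\<forall>a\<in>A. \<forall>K\<in>Collect finite.
     (\<Sum>k\<in>K. cmod (conv_seq (c x) a k) powr p) \<le> b powr p * (\<Sum>j | a j \<noteq> 0. cmod (a j) powr p))}"
    using Inf_conv_bound_le_iff[OF p K(1) K(2)] conv_bound_dense_iff[OF p A(2,3)] by blast
  also have "\<dots> \<in> sets M"
    by measurable
  finally show "{x \<in> space M. Inf {C. 0 \<le> C \<and> conv_bound p (c x) C} \<le> b} \<in> sets M" .
qed

section \<open>Compactly supported Schwartz functions\<close>

text \<open>The classical function exp(-1/x) extended by 0, together with the powers of 1/x that its
  derivatives produce.\<close>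

definition flat :: "nat \<Rightarrow> real \<Rightarrow> real" where
  "flat k x = (if 0 < x then exp (- inverse x) * inverse x ^ k else 0)"

lemma flat_tendsto_0: "(flat k \<longlongrightarrow> 0) (at 0)"
  unfolding filterlim_at_split
proof
  show "(flat k \<longlongrightarrow> 0) (at_left 0)"
    by (rule tendsto_eventually) (auto simp: eventually_at_filter flat_def)
  have "((\<lambda>x. inverse x ^ k / exp (inverse x)) \<longlongrightarrow> (0::real)) (at_right 0)"
    by (rule filterlim_compose[OF tendsto_power_div_exp_0 filterlim_inverse_at_top_right])
  moreover have "\<forall>\<^sub>F x in at_right 0. inverse x ^ k / exp (inverse x) = flat k x"
    by (auto simp: eventually_at_filter flat_def exp_minus field_simps)
  ultimately show "(flat k \<longlongrightarrow> 0) (at_right 0)"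
    by (rule Lim_transform_eventually)
qed

lemma flat_deriv: "(flat k has_real_derivative flat (k + 2) x - real k * flat (k + 1) x) (at x)"
proof -
  consider "x > 0" | "x < 0" | "x = 0" by linarith
  then show ?thesis
  proof cases
    case 1
    have "((\<lambda>x. exp (- inverse x) * inverse x ^ k) has_real_derivative
        flat (k + 2) x - real k * flat (k + 1) x) (at x)"
      using 1
      by (auto intro!: derivative_eq_intros simp: flat_def field_simps power_add power2_eq_square)
         (cases k; simp add: field_simps)
    then show ?thesis
      by (rule has_field_derivative_transform_within_open[where S = "{0<..}"])
         (use 1 in \<open>auto simp: flat_def\<close>)
  next
    case 2
    have "((\<lambda>x. 0) has_real_derivative 0) (at x)" by simp
    then have "(flat k has_real_derivative 0) (at x)"
      by (rule has_field_derivative_transform_within_open[where S = "{..<0}"])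
         (use 2 in \<open>auto simp: flat_def\<close>)
    then show ?thesis using 2 by (simp add: flat_def)
  next
    case 3
    \<comment> \<open>The difference quotient of \<open>flat k\<close> at 0 is
      \<open>flat (Suc k)\<close>, which tends to 0.\<close>
    have "(flat k has_real_derivative 0) (at 0)"
      unfolding DERIV_def
      by (rule Lim_transform_eventually[OF flat_tendsto_0[of "Suc k"]])
         (auto simp: eventually_at_filter flat_def field_simps)
    then show ?thesis using 3 by (simp add: flat_def)
  qed
qed

text \<open>All \<open>flat i\<close> are needed, not just \<open>flat 0\<close>: this makes the span closed under differentiation.\<close>

inductive_set bump_span :: "(real \<Rightarrow> complex) set" where
  atom: "(\<lambda>x. c * of_real (flat i (x + s) * flat j (1 - (x + s)))) \<in> bump_span"
| add: "f \<in> bump_span \<Longrightarrow> g \<in> bump_span \<Longrightarrow> (\<lambda>x. f x + g x) \<in> bump_span"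

lemma bump_span_deriv:
  assumes "f \<in> bump_span"
  obtains f' where "f' \<in> bump_span" "\<And>x. (f has_vector_derivative f' x) (at x)"
proof -
  have "\<exists>f'\<in>bump_span. \<forall>x. (f has_vector_derivative f' x) (at x)"
    using assms
  proof induction
    case (atom c i s j)
    let ?b = "\<lambda>c i j x. c * complex_of_real (flat i (x + s) * flat j (1 - (x + s)))"
    \<comment> \<open>The product rule yields two atoms from each factor; the signs in the second
      pair come from the inner function 1 - (x + s).\<close>
    let ?f' = "\<lambda>x. (?b c (i + 2) j x + ?b (- c * of_nat i) (i + 1) j x) +
       (?b (- c) i (j + 2) x + ?b (c * of_nat j) i (j + 1) x)"
    have "?f' \<in> bump_span" by (intro bump_span.intros)
    moreover have "(?b c i j has_vector_derivative ?f' x) (at x)" for x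
    proof -
      have 1: "((\<lambda>x. flat i (x + s)) has_real_derivative flat (i + 2) (x + s) - real i * flat (i + 1) (x + s)) (at x)"
      proof -
        have "((\<lambda>x. x + s) has_real_derivative 1) (at x)"
          by (auto intro!: derivative_eq_intros)
        from DERIV_chain2[where f = "flat i" and g = "\<lambda>x. x + s", OF flat_deriv this] show ?thesis by simp
      qed
      have 2: "((\<lambda>x. flat j (1 - (x + s))) has_real_derivative
          - (flat (j + 2) (1 - (x + s)) - real j * flat (j + 1) (1 - (x + s)))) (at x)"
      proof -
        have "((\<lambda>x. 1 - (x + s)) has_real_derivative - 1) (at x)"
          by (auto intro!: derivative_eq_intros)
        from DERIV_chain2[where f = "flat j" and g = "\<lambda>x. 1 - (x + s)", OF flat_deriv this] show ?thesis by simp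
      qed
      have "((\<lambda>x. flat i (x + s) * flat j (1 - (x + s))) has_real_derivative
         (flat (i + 2) (x + s) - real i * flat (i + 1) (x + s)) * flat j (1 - (x + s)) +
         flat i (x + s) * - (flat (j + 2) (1 - (x + s)) - real j * flat (j + 1) (1 - (x + s)))) (at x)"
        using DERIV_mult[OF 1 2] by (simp add: algebra_simps)
      from has_vector_derivative_mult_right[OF has_vector_derivative_of_real[OF this], of c]
      show ?thesis by (rule has_vector_derivative_eq_rhs) (simp add: algebra_simps)
    qed
    ultimately show ?case by (intro bexI[of _ ?f']) auto
  next
    case (add f g)
    then obtain f' g' where "f' \<in> bump_span" "g' \<in> bump_span"
      "\<forall>x. (f has_vector_derivative f' x) (at x)" "\<forall>x. (g has_vector_derivative g' x) (at x)"
      by blast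
    then show ?case
      by (intro bexI[of _ "\<lambda>x. f' x + g' x"]) (auto intro: has_vector_derivative_add bump_span.add)
  qed
  then show ?thesis using that by blast
qed

lemma bump_span_continuous:
  assumes "f \<in> bump_span"
  shows "continuous_on S f"
proof -
  obtain f' where "\<And>x. (f has_vector_derivative f' x) (at x)"
    using bump_span_deriv[OF assms] by blast
  then have "isCont f x" for x using has_vector_derivative_continuous by blast
  then show ?thesis by (simp add: continuous_at_imp_continuous_on)
qed

lemma bump_span_support:
  assumes "f \<in> bump_span"
  obtains R where "0 < R" "\<And>x. R \<le> \<bar>x\<bar> \<Longrightarrow> f x = 0"
proof -
  have "\<exists>R>0. \<forall>x. R \<le> \<bar>x\<bar> \<longrightarrow> f x = 0"
    using assms
  proof induction
    case (atom c i s j)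
    show ?case by (intro exI[of _ "1 + \<bar>s\<bar>"]) (auto simp: flat_def)
  next
    case (add f g)
    then obtain R R' where "R > 0" "R' > 0" "\<forall>x. R \<le> \<bar>x\<bar> \<longrightarrow> f x = 0" "\<forall>x. R' \<le> \<bar>x\<bar> \<longrightarrow> g x = 0"
      by blast
    then show ?case by (intro exI[of _ "max R R'"]) auto
  qed
  then show ?thesis using that by blast
qed

text \<open>The span is closed under differentiation, so one choice function \<open>d\<close>,
  iterated, supplies all derivatives at once. Each of them is continuous with compact support, hence
  bounded after multiplication by any power of x.\<close>

lemma bump_span_schwartz:
  assumes "f \<in> bump_span"
  shows "f \<in> schwartz"
proof -
  obtain d where d: "\<And>f. f \<in> bump_span \<Longrightarrow> d f \<in> bump_span \<and> (\<forall>x. (f has_vector_derivative d f x) (at x))"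
  proof -
    have "\<forall>f\<in>bump_span. \<exists>f'. f' \<in> bump_span \<and> (\<forall>x. (f has_vector_derivative f' x) (at x))"
      by (meson bump_span_deriv)
    from bchoice[OF this] show ?thesis using that by blast
  qed
  define D where "D n = (d ^^ n) f" for n
  have D: "D n \<in> bump_span" for n
    by (induction n) (use assms d in \<open>auto simp: D_def\<close>)
  have "bounded (range (\<lambda>x. (x ^ k) *\<^sub>R D n x))" for n k
  proof -
    obtain R where R: "0 < R" "\<And>x. R \<le> \<bar>x\<bar> \<Longrightarrow> D n x = 0"
      using bump_span_support[OF D] by blast
    let ?g = "\<lambda>x. (x ^ k) *\<^sub>R D n x"
    have "compact (?g ` {-R..R})"
      by (intro compact_continuous_image continuous_intros bump_span_continuous D compact_Icc)
    then have "bounded (insert 0 (?g ` {-R..R}))" by (simp add: compact_imp_bounded)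
    moreover have "range ?g \<subseteq> insert 0 (?g ` {-R..R})"
    proof
      fix z assume "z \<in> range ?g"
      then obtain x where x: "z = ?g x" by blast
      show "z \<in> insert 0 (?g ` {-R..R})"
      proof (cases "R \<le> \<bar>x\<bar>")
        case False
        then have "x \<in> {-R..R}" by auto
        then show ?thesis using x by blast
      qed (use R x in auto)
    qed
    ultimately show ?thesis by (rule bounded_subset)
  qed
  moreover have "(D n has_vector_derivative D (Suc n) x) (at x)" for n x
    using d[OF D[of n]] by (simp add: D_def)
  moreover have "D 0 = f" by (simp add: D_def)
  ultimately show ?thesis unfolding schwartz_def by blast
qed

definition bump :: "real \<Rightarrow> complex" where
  "bump x = of_real (flat 0 x * flat 0 (1 - x))"

lemma bump_shift_in_span: "(\<lambda>x. c * bump (x + s)) \<in> bump_span"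
  using bump_span.atom[of c 0 s 0] by (simp add: bump_def)

lemma bump_in_span: "bump \<in> bump_span"
  using bump_shift_in_span[of 1 0] by simp

lemma sum_bump_in_span:
  assumes "finite F"
  shows "(\<lambda>x. \<Sum>j\<in>F. a j * bump (x + s j)) \<in> bump_span"
  using assms
proof induction
  case empty
  show ?case using bump_shift_in_span[of 0 0] by simp
next
  case (insert j F)
  then show ?case using bump_span.add[OF bump_shift_in_span[of "a j" "s j"] insert.IH] by simp
qed

lemma bump_eq_0: "x \<le> 0 \<or> 1 \<le> x \<Longrightarrow> bump x = 0"
  by (auto simp: bump_def flat_def)

lemma bump_neq_0: "0 < x \<Longrightarrow> x < 1 \<Longrightarrow> bump x \<noteq> 0"
  by (simp add: bump_def flat_def)

section \<open>Fourier series and Poisson summation\<close>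

lemma has_vector_derivative_imp_tendsto:
  assumes "(f has_vector_derivative D) (at x)"
  shows "((\<lambda>y. (f y - f x) /\<^sub>R (y - x)) \<longlongrightarrow> D) (at x)"
proof -
  have "((\<lambda>y. norm (f y - f x - (y - x) *\<^sub>R D) / norm (y - x)) \<longlongrightarrow> 0) (at x)"
    using assms by (simp add: has_vector_derivative_def has_derivative_iff_norm)
  moreover have "\<forall>\<^sub>F y in at x. norm (f y - f x - (y - x) *\<^sub>R D) / norm (y - x) = dist ((f y - f x) /\<^sub>R (y - x)) D"
    unfolding eventually_at_filter
  proof (rule always_eventually, intro allI impI)
    fix y assume "y \<noteq> x"
    then have "f y - f x - (y - x) *\<^sub>R D = (y - x) *\<^sub>R ((f y - f x) /\<^sub>R (y - x) - D)"
      by (simp add: scaleR_diff_right)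
    with \<open>y \<noteq> x\<close> show "norm (f y - f x - (y - x) *\<^sub>R D) / norm (y - x) = dist ((f y - f x) /\<^sub>R (y - x)) D"
      by (simp add: dist_norm)
  qed
  ultimately have "((\<lambda>y. dist ((f y - f x) /\<^sub>R (y - x)) D) \<longlongrightarrow> 0) (at x)"
    by (rule Lim_transform_eventually)
  then show ?thesis by (rule iffD2[OF tendsto_dist_iff])
qed

lemma has_vector_derivative_cis:
  "((\<lambda>x. cis (s * x)) has_vector_derivative \<i> * of_real s * cis (s * x)) (at x within S)"
proof -
  have "((\<lambda>x. cis (s * x)) has_derivative (\<lambda>h. (s * h) *\<^sub>R (\<i> * cis (s * x)))) (at x within S)"
    by (rule has_derivative_cis) (auto intro!: derivative_eq_intros)
  then show ?thesis
    by (simp add: has_vector_derivative_def scaleR_conv_of_real mult_ac)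
qed

text \<open>The factor \<open>\<i> * of_real s\<close> is left on the side of the integral instead
  of being divided out, so the identity also covers s = 0.\<close>

lemma cis_integral_by_parts:
  fixes r :: "real \<Rightarrow> complex"
  assumes ab: "a \<le> b" and r: "\<And>x. (r has_vector_derivative r' x) (at x)" and r': "continuous_on {a..b} r'"
  shows "\<i> * of_real s * integral {a..b} (\<lambda>x. r x * cis (s * x)) =
    r b * cis (s * b) - r a * cis (s * a) - integral {a..b} (\<lambda>x. r' x * cis (s * x))"
proof -
  have cr: "continuous_on {a..b} r"
    using r has_vector_derivative_continuous by (metis continuous_at_imp_continuous_on)
  have "((\<lambda>x. r x * (\<i> * of_real s * cis (s * x)) + r' x * cis (s * x)) has_integral
      r b * cis (s * b) - r a * cis (s * a)) {a..b}"
    by (intro fundamental_theorem_of_calculus ab has_vector_derivative_mult has_vector_derivative_cis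
          has_vector_derivative_at_within[OF r])
  then have "integral {a..b} (\<lambda>x. r x * (\<i> * of_real s * cis (s * x)) + r' x * cis (s * x)) =
      r b * cis (s * b) - r a * cis (s * a)"
    by (rule integral_unique)
  also have "integral {a..b} (\<lambda>x. r x * (\<i> * of_real s * cis (s * x)) + r' x * cis (s * x)) =
      integral {a..b} (\<lambda>x. \<i> * of_real s * (r x * cis (s * x))) + integral {a..b} (\<lambda>x. r' x * cis (s * x))"
    by (subst integral_add[symmetric])
       (auto intro!: integrable_continuous_real continuous_intros cr r' simp: mult_ac)
  finally show ?thesis by (simp add: algebra_simps)
qed

text \<open>By Stone-Weierstrass \<open>q\<close> is uniformly close to a polynomial
  \<open>g\<close>. Integration by parts bounds the integral for \<open>g\<close> by K / |s|, where
  \<open>K\<close> collects the boundary terms and a bound of the derivative.\<close>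

lemma Riemann_Lebesgue_continuous:
  fixes q :: "real \<Rightarrow> complex"
  assumes q: "continuous_on {0..1} q"
  shows "((\<lambda>s. integral {0..1} (\<lambda>x. q x * cis (s * x))) \<longlongrightarrow> 0) at_infinity"
proof (rule tendstoI)
  fix e :: real assume e: "0 < e"
  obtain g where g: "polynomial_function g" "\<And>x. x \<in> {0..1} \<Longrightarrow> norm (q x - g x) < e / 2"
    using Stone_Weierstrass_polynomial_function[OF compact_Icc q, of "e / 2"] e by auto
  obtain g' where g': "polynomial_function g'" "\<And>x. (g has_vector_derivative g' x) (at x)"
    using has_vector_derivative_polynomial_function[OF g(1)] by blast
  have cg: "continuous_on {0..1} g" "continuous_on {0..1} g'"
    using g(1) g'(1) continuous_on_polymonial_function by blast+
  obtain B where B: "\<And>x. x \<in> {0..1} \<Longrightarrow> norm (g' x) \<le> B"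
    using compact_imp_bounded[OF compact_continuous_image[OF cg(2) compact_Icc]]
    unfolding bounded_iff by blast
  define K where "K = norm (g 1) + norm (g 0) + B"
  have "B \<ge> 0" using B[of 0] norm_ge_zero[of "g' 0"] by (auto simp del: norm_ge_zero)
  then have K: "0 \<le> K" unfolding K_def by simp
  \<comment> \<open>Beyond this threshold K / |s| is at most e / 4, which together with the e / 2
    from the approximation stays below \<open>e\<close>. The summand 1 excludes s = 0 when K =
    0.\<close>
  have bound: "norm (integral {0..1} (\<lambda>x. q x * cis (s * x))) < e" if s: "4 * K / e + 1 \<le> norm s" for s
  proof -
    have s0: "\<bar>s\<bar> > 0" using s K e by (smt (verit) divide_nonneg_pos norm_eq_zero real_norm_def zero_less_norm_iff mult_nonneg_nonneg)
    have "\<bar>s\<bar> * norm (integral {0..1} (\<lambda>x. g x * cis (s * x))) =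
        norm (\<i> * of_real s * integral {0..1} (\<lambda>x. g x * cis (s * x)))"
      by (simp add: norm_mult)
    also have "\<dots> \<le> norm (g 1) + norm (g 0) + norm (integral {0..1} (\<lambda>x. g' x * cis (s * x)))"
      unfolding cis_integral_by_parts[OF zero_le_one g'(2) cg(2)]
      by (rule order_trans[OF norm_triangle_ineq4 add_right_mono]) 
         (rule order_trans[OF norm_triangle_ineq4], simp add: norm_mult)
    also have "norm (integral {0..1} (\<lambda>x. g' x * cis (s * x))) \<le> B * (1 - 0)"
      by (rule integral_bound) (auto intro!: continuous_intros cg B simp: norm_mult)
    finally have "\<bar>s\<bar> * norm (integral {0..1} (\<lambda>x. g x * cis (s * x))) \<le> K" by (simp add: K_def)
    then have "norm (integral {0..1} (\<lambda>x. g x * cis (s * x))) \<le> K / \<bar>s\<bar>"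
      using s0 by (simp add: field_simps)
    also have "\<dots> \<le> e / 4"
    proof -
      have "4 * K / e \<le> \<bar>s\<bar>" using s by simp
      then show ?thesis using e s0 by (simp add: field_simps)
    qed
    finally have 1: "norm (integral {0..1} (\<lambda>x. g x * cis (s * x))) \<le> e / 4" .
    have 2: "norm (integral {0..1} (\<lambda>x. (q x - g x) * cis (s * x))) \<le> e / 2 * (1 - 0)"
    proof (rule integral_bound)
      show "norm ((q t - g t) * cis (s * t)) \<le> e / 2" if "t \<in> {0..1}" for t
        using less_imp_le[OF g(2)[OF that]] by (simp add: norm_mult)
    qed (auto intro!: continuous_intros q cg)
    have "integral {0..1} (\<lambda>x. q x * cis (s * x)) =
        integral {0..1} (\<lambda>x. (q x - g x) * cis (s * x)) + integral {0..1} (\<lambda>x. g x * cis (s * x))"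
      by (subst integral_add[symmetric])
         (auto intro!: integrable_continuous_real continuous_intros q cg simp: algebra_simps)
    then have "norm (integral {0..1} (\<lambda>x. q x * cis (s * x))) \<le> e / 2 + e / 4"
      using 1 2 norm_triangle_ineq[of "integral {0..1} (\<lambda>x. (q x - g x) * cis (s * x))" "integral {0..1} (\<lambda>x. g x * cis (s * x))"]
      by simp
    then show ?thesis using e by simp
  qed
  show "\<forall>\<^sub>F s in at_infinity. dist (integral {0..1} (\<lambda>x. q x * cis (s * x))) 0 < e"
    unfolding eventually_at_infinity using bound by (intro exI[of _ "4 * K / e + 1"]) (auto simp del: real_norm_def)
qed

lemma cis_eq_1_imp_eq_0:
  assumes "cis (2 * pi * x) = 1" "\<bar>x\<bar> < 1"
  shows "x = 0"
proof -
  have "cos (2 * pi * x) = 1" using assms(1) by (simp add: complex_eq_iff)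
  then obtain n :: int where "2 * pi * x = of_int n * 2 * pi"
    using cos_one_2pi_int by auto
  then have "x = of_int n" by (simp add: field_simps)
  with assms(2) show ?thesis by simp
qed

lemma integral_cis_int:
  "integral {0..1} (\<lambda>x. cis (2 * pi * of_int n * x)) = (if n = 0 then 1 else 0)"
proof (cases "n = 0")
  case False
  have "\<i> * of_real (2 * pi * of_int n) * integral {0..1} (\<lambda>x. 1 * cis (2 * pi * of_int n * x)) = 0"
    by (subst cis_integral_by_parts[where r' = "\<lambda>_. 0"]) auto
  then show ?thesis using False by simp
qed simp

lemma symm_sum_telescope:
  "(\<Sum>n = - int N..int N. Q (n - 1) - Q n) = Q (- int N - 1) - (Q (int N) :: 'a :: ab_group_add)"
proof (induction N)
  case (Suc N)
  have "(\<Sum>n = - int (Suc N)..int (Suc N). Q (n - 1) - Q n) =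
      (Q (- int N - 1 - 1) - Q (- int N - 1)) + ((Q (int (Suc N) - 1) - Q (int (Suc N))) + (\<Sum>n = - int N..int N. Q (n - 1) - Q n))"
  proof -
    have "{- int (Suc N)..int (Suc N)} = insert (- int N - 1) (insert (int (Suc N)) {- int N..int N})"
      by auto
    then show ?thesis by simp
  qed
  also have "\<dots> = Q (- int N - 1 - 1) - Q (int (Suc N))"
    unfolding Suc.IH by simp
  finally show ?case by simp
qed simp

text \<open>Writing \<open>h t - h y = q t * (cis (2 * pi * (t - y)) - 1)\<close> with \<open>q\<close> continuous, the partial
  sums telescope and the Riemann-Lebesgue lemma for \<open>q\<close> applies.\<close>

lemma Fourier_series_converges:
  fixes h :: "real \<Rightarrow> complex"
  assumes h: "continuous_on {0..1} h" and h': "(h has_vector_derivative h') (at y)" and y: "0 < y" "y < 1"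
  shows "(\<lambda>N. \<Sum>n = - int N..int N. integral {0..1} (\<lambda>t. h t * cis (- (2 * pi * of_int n * (t - y))))) \<longlonglongrightarrow> h y"
proof -
  define d where "d t = cis (2 * pi * (t - y)) - 1" for t
  \<comment> \<open>The value at \<open>y\<close> is the limit of the quotient: numerator and
    denominator both vanish there, with derivatives h' and 2 * pi * \<i>.\<close>
  define q where "q t = (if t = y then h' / (2 * pi * \<i>) else (h t - h y) / d t)" for t
  \<comment> \<open>Here \<open>y\<close> has to be interior: then |t - y| < 1 on the whole closed
    interval, whereas for y = 0 the point t = 1 would be a second zero of \<open>d\<close>.\<close>
  have d0: "d t \<noteq> 0" if "t \<in> {0..1}" "t \<noteq> y" for t
  proof -
    have "\<bar>t - y\<bar> < 1" using that y by auto
    then show ?thesis using cis_eq_1_imp_eq_0[of "t - y"] that by (auto simp: d_def)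
  qed
  have hd: "h t - h y = q t * d t" if "t \<in> {0..1}" for t
    using d0[OF that] by (auto simp: q_def d_def)
  have qlim: "(q \<longlongrightarrow> q y) (at y within {0..1})"
  proof -
    have "(d has_vector_derivative 2 * pi * \<i>) (at y)"
    proof -
      have "((\<lambda>t. cis (2 * pi * t) * cis (- (2 * pi * y)) - 1) has_vector_derivative
         (\<i> * of_real (2 * pi) * cis (2 * pi * y)) * cis (- (2 * pi * y)) - 0) (at y)"
        by (intro has_vector_derivative_diff has_vector_derivative_const has_vector_derivative_mult_left has_vector_derivative_cis)
      moreover have "(\<lambda>t. cis (2 * pi * t) * cis (- (2 * pi * y)) - 1) = d"
        by (simp add: d_def[abs_def] cis_mult right_diff_distrib)
      moreover have "(\<i> * of_real (2 * pi) * cis (2 * pi * y)) * cis (- (2 * pi * y)) - 0 = 2 * pi * \<i>"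
        by (simp add: cis_mult mult.assoc)
      ultimately show ?thesis by metis
    qed
    then have "((\<lambda>t. (d t - d y) /\<^sub>R (t - y)) \<longlongrightarrow> 2 * pi * \<i>) (at y)"
      by (rule has_vector_derivative_imp_tendsto)
    then have "((\<lambda>t. ((h t - h y) /\<^sub>R (t - y)) / ((d t - d y) /\<^sub>R (t - y))) \<longlongrightarrow> h' / (2 * pi * \<i>)) (at y)"
      by (intro tendsto_divide has_vector_derivative_imp_tendsto[OF h']) auto
    moreover have "\<forall>\<^sub>F t in at y. ((h t - h y) /\<^sub>R (t - y)) / ((d t - d y) /\<^sub>R (t - y)) = q t"
      by (auto simp: eventually_at_filter q_def d_def scaleR_conv_of_real divide_simps intro!: always_eventually)
    ultimately have "(q \<longlongrightarrow> q y) (at y)"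
      unfolding q_def[of y] by (auto intro: Lim_transform_eventually)
    then show ?thesis by (rule tendsto_within_subset) simp
  qed
  have cd: "continuous_on A d" for A unfolding d_def by (intro continuous_intros)
  have cq: "continuous_on {0..1} q"
    unfolding continuous_on_def
  proof
    fix x :: real assume x: "x \<in> {0..1}"
    show "(q \<longlongrightarrow> q x) (at x within {0..1})"
    proof (cases "x = y")
      case False
      have "((\<lambda>t. (h t - h y) / d t) \<longlongrightarrow> (h x - h y) / d x) (at x within {0..1})"
        using h cd[of "{0..1}"] x d0[OF x False]
        by (intro tendsto_intros) (auto simp: continuous_on_def)
      moreover have "\<forall>\<^sub>F t in at x within {0..1}. (h t - h y) / d t = q t"
        using False unfolding eventually_at
        by (intro exI[of _ "dist x y"]) (auto simp: q_def dist_commute)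
      ultimately show ?thesis
        using False by (auto simp: q_def[of x] intro: Lim_transform_eventually)
    qed (use qlim in simp)
  qed
  define Q where "Q n = integral {0..1} (\<lambda>t. q t * cis (- (2 * pi * of_int n * (t - y))))" for n :: int
  \<comment> \<open>Multiplication by \<open>cis (2 * pi * (t - y))\<close> lowers the frequency
    index by one, which gives Q (n - 1) - Q n; the constant h y is seen only by n = 0.\<close>
  have coeff_eq: "integral {0..1} (\<lambda>t. h t * cis (- (2 * pi * of_int n * (t - y)))) =
      (if n = 0 then h y else 0) + (Q (n - 1) - Q n)" for n
  proof -
    have "integral {0..1} (\<lambda>t. h t * cis (- (2 * pi * of_int n * (t - y)))) =
      integral {0..1} (\<lambda>t. h y * cis (2 * pi * of_int n * y) * cis (2 * pi * of_int (- n) * t) +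
         (q t * cis (- (2 * pi * of_int (n - 1) * (t - y))) - q t * cis (- (2 * pi * of_int n * (t - y)))))"
    proof (rule integral_cong)
      fix t :: real assume t: "t \<in> {0..1}"
      have e1: "cis (2 * pi * of_int n * y) * cis (2 * pi * of_int (- n) * t) = cis (- (2 * pi * of_int n * (t - y)))"
        by (simp add: cis_mult algebra_simps)
      have e2: "cis (- (2 * pi * of_int (n - 1) * (t - y))) = cis (2 * pi * (t - y)) * cis (- (2 * pi * of_int n * (t - y)))"
        by (simp add: cis_mult algebra_simps)
      have "h t = h y + q t * (cis (2 * pi * (t - y)) - 1)"
        using hd[OF t] unfolding d_def by (metis add.commute diff_add_cancel)
      then have "h t * E = h y * E + (q t * (cis (2 * pi * (t - y)) * E) - q t * E)" for E
        by (metis (no_types, opaque_lifting) distrib_right left_diff_distrib mult.assoc mult_1 right_diff_distrib)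
      then show "h t * cis (- (2 * pi * of_int n * (t - y))) =
         h y * cis (2 * pi * of_int n * y) * cis (2 * pi * of_int (- n) * t) +
         (q t * cis (- (2 * pi * of_int (n - 1) * (t - y))) - q t * cis (- (2 * pi * of_int n * (t - y))))"
        unfolding mult.assoc[of "h y"] e1 e2 .
    qed
    also have "\<dots> = h y * cis (2 * pi * of_int n * y) * integral {0..1} (\<lambda>t. cis (2 * pi * of_int (- n) * t)) + (Q (n - 1) - Q n)"
    proof -
      have i1: "(\<lambda>t. h y * cis (2 * pi * of_int n * y) * cis (2 * pi * of_int (- n) * t)) integrable_on {0..1}"
        by (intro integrable_continuous_real continuous_intros)
      have i2: "(\<lambda>t. q t * cis (- (2 * pi * of_int m * (t - y)))) integrable_on {0..1}" for m
        by (intro integrable_continuous_real continuous_intros cq)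
      show ?thesis
        unfolding Q_def integral_add[OF i1 integrable_diff[OF i2 i2]] integral_diff[OF i2 i2] by simp
    qed
    also have "integral {0..1} (\<lambda>t. cis (2 * pi * of_int (- n) * t)) = (if n = 0 then 1 else 0)"
      by (subst integral_cis_int) simp
    finally show ?thesis by simp
  qed
  have sum: "(\<Sum>n = - int N..int N. integral {0..1} (\<lambda>t. h t * cis (- (2 * pi * of_int n * (t - y))))) =
      h y + (Q (- int N - 1) - Q (int N))" for N
    unfolding coeff_eq sum.distrib symm_sum_telescope by simp
  \<comment> \<open>\<open>Q\<close> carries the phase of t - y and the Riemann-Lebesgue lemma that
    of t. They differ by a factor of modulus 1 depending on n, so the limit is taken on
    norms.\<close>
  have Q_lim: "(\<lambda>N. Q (f N)) \<longlonglongrightarrow> 0" if f: "filterlim (\<lambda>N. real_of_int (f N)) at_infinity sequentially" for f :: "nat \<Rightarrow> int"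
  proof (rule tendsto_norm_zero_cancel)
    have "filterlim (\<lambda>N. (- (2 * pi)) * real_of_int (f N)) at_infinity sequentially"
      by (rule tendsto_mult_filterlim_at_infinity[OF tendsto_const _ f]) simp
    then have "(\<lambda>N. integral {0..1} (\<lambda>t. q t * cis ((- (2 * pi)) * real_of_int (f N) * t))) \<longlonglongrightarrow> 0"
      by (rule filterlim_compose[OF Riemann_Lebesgue_continuous[OF cq]])
    then have "(\<lambda>N. norm (integral {0..1} (\<lambda>t. q t * cis ((- (2 * pi)) * real_of_int (f N) * t)))) \<longlonglongrightarrow> 0"
      by (rule tendsto_norm_zero)
    moreover have "norm (integral {0..1} (\<lambda>t. q t * cis ((- (2 * pi)) * real_of_int (f N) * t))) = norm (Q (f N))" for N
    proof -
      have "Q (f N) = integral {0..1} (\<lambda>t. cis (2 * pi * of_int (f N) * y) * (q t * cis ((- (2 * pi)) * real_of_int (f N) * t)))"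
        unfolding Q_def by (rule integral_cong) (simp add: cis_mult algebra_simps)
      then show ?thesis by (simp add: norm_mult)
    qed
    ultimately show "(\<lambda>N. norm (Q (f N))) \<longlonglongrightarrow> 0" by simp
  qed
  have "(\<lambda>N. Q (int N)) \<longlonglongrightarrow> 0"
    by (rule Q_lim) (simp add: filterlim_at_top_imp_at_infinity filterlim_real_sequentially)
  moreover have "(\<lambda>N. Q (- int N - 1)) \<longlonglongrightarrow> 0"
  proof (rule Q_lim)
    have "filterlim (\<lambda>N. - real (Suc N)) at_bot sequentially"
      unfolding filterlim_uminus_at_bot minus_minus
      by (rule filterlim_compose[OF filterlim_real_sequentially filterlim_Suc])
    from filterlim_mono[OF this at_bot_le_at_infinity order_refl]
    show "filterlim (\<lambda>N. real_of_int (- int N - 1)) at_infinity sequentially"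
      by (rule filterlim_cong[THEN iffD1, rotated -1]) auto
  qed
  ultimately have "(\<lambda>N. h y + (Q (- int N - 1) - Q (int N))) \<longlonglongrightarrow> h y + (0 - 0)"
    by (intro tendsto_intros)
  then show ?thesis unfolding sum by simp
qed

section \<open>Fourier transforms of compactly supported smooth functions\<close>

lemma lebesgue_integral_compact_support:
  fixes f :: "real \<Rightarrow> 'a::euclidean_space"
  assumes f: "continuous_on UNIV f" and supp: "\<And>x. x \<notin> {a..b} \<Longrightarrow> f x = 0"
  shows "integrable lebesgue f" "integral\<^sup>L lebesgue f = integral {a..b} f"
proof -
  have eq: "(\<lambda>x. indicator {a..b} x *\<^sub>R f x) = f"
    using supp by (auto simp: fun_eq_iff indicator_def)
  have set: "set_integrable lborel {a..b} f"
    by (rule borel_integrable_atLeastAtMost') (rule continuous_on_subset[OF f], simp)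
  have [measurable]: "f \<in> borel_measurable lborel"
    using borel_measurable_continuous_onI[OF f] by simp
  have "integrable lborel f"
    using set unfolding set_integrable_def eq .
  then show "integrable lebesgue f" by (simp add: integrable_completion)
  have "integral\<^sup>L lebesgue f = integral\<^sup>L lborel f" by (simp add: integral_completion)
  also have "\<dots> = integral {a..b} f"
    using set_borel_integral_eq_integral(2)[OF set] unfolding set_lebesgue_integral_def eq .
  finally show "integral\<^sup>L lebesgue f = integral {a..b} f" .
qed

lemma bump_span_support_Icc:
  assumes "f \<in> bump_span" "g \<in> bump_span"
  obtains R where "0 < R" "f R = 0" "f (-R) = 0" "g R = 0" "g (-R) = 0"
    "\<And>x. x \<notin> {-R..R} \<Longrightarrow> f x = 0" "\<And>x. x \<notin> {-R..R} \<Longrightarrow> g x = 0"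
proof -
  obtain R R' where "0 < R" "\<And>x. R \<le> \<bar>x\<bar> \<Longrightarrow> f x = 0" "0 < R'" "\<And>x. R' \<le> \<bar>x\<bar> \<Longrightarrow> g x = 0"
    using bump_span_support assms by metis
  then show ?thesis by (intro that[of "max R R'"]) auto
qed

lemma bump_span_integrable:
  assumes "f \<in> bump_span"
  shows "integrable lebesgue (\<lambda>x. f x * cis (s * x))"
proof -
  obtain R where "\<And>x. x \<notin> {-R..R} \<Longrightarrow> f x = 0"
    using bump_span_support_Icc[OF assms assms] by blast
  then show ?thesis
    by (intro lebesgue_integral_compact_support[of _ "-R" R] continuous_intros bump_span_continuous assms) auto
qed

lemma bump_span_powr_integrable:
  assumes "f \<in> bump_span" "0 < p"
  shows "integrable lebesgue (\<lambda>x. cmod (f x) powr p)"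
proof -
  obtain R where "\<And>x. x \<notin> {-R..R} \<Longrightarrow> f x = 0"
    using bump_span_support_Icc[OF assms(1,1)] by blast
  then show ?thesis
    using assms(2)
    by (intro lebesgue_integral_compact_support[of _ "-R" R] continuous_on_powr' continuous_intros bump_span_continuous assms) auto
qed

lemma bump_span_in_Lp:
  assumes "f \<in> bump_span" "0 < p"
  shows "f \<in> Lp p lebesgue"
proof -
  have "f \<in> borel_measurable borel"
    by (rule borel_measurable_continuous_onI) (rule bump_span_continuous[OF assms(1)])
  then have "f \<in> borel_measurable lebesgue" by (simp add: measurable_completion)
  then show ?thesis using bump_span_powr_integrable[OF assms] by (simp add: Lp_def)
qed

lemma fourier_R_compact_support:
  assumes f: "continuous_on UNIV f" and supp: "\<And>x. x \<notin> {a..b} \<Longrightarrow> f x = 0"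
  shows "fourier_R f \<xi> = integral {a..b} (\<lambda>x. f x * cis (- (2 * pi * \<xi>) * x))"
proof -
  have "continuous_on UNIV (\<lambda>x. f x * cis (- (2 * pi * \<xi>) * x))"
    by (intro continuous_intros f)
  from lebesgue_integral_compact_support(2)[OF this, of a b] supp show ?thesis
    by (simp add: fourier_R_def)
qed

lemma fourier_R_deriv:
  assumes f: "f \<in> bump_span" "f' \<in> bump_span" "\<And>x. (f has_vector_derivative f' x) (at x)"
  shows "fourier_R f' \<xi> = \<i> * of_real (2 * pi * \<xi>) * fourier_R f \<xi>"
proof -
  obtain R where R: "0 < R" "f R = 0" "f (-R) = 0"
    "\<And>x. x \<notin> {-R..R} \<Longrightarrow> f x = 0" "\<And>x. x \<notin> {-R..R} \<Longrightarrow> f' x = 0"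
    using bump_span_support_Icc[OF f(1,2)] by metis
  have "\<i> * of_real (- (2 * pi * \<xi>)) * integral {-R..R} (\<lambda>x. f x * cis (- (2 * pi * \<xi>) * x)) =
      - integral {-R..R} (\<lambda>x. f' x * cis (- (2 * pi * \<xi>) * x))"
    by (subst cis_integral_by_parts[OF _ f(3) bump_span_continuous[OF f(2)]]) (use R in auto)
  moreover have "fourier_R f \<xi> = integral {-R..R} (\<lambda>x. f x * cis (- (2 * pi * \<xi>) * x))"
    by (rule fourier_R_compact_support[OF bump_span_continuous[OF f(1)] R(4)])
  moreover have "fourier_R f' \<xi> = integral {-R..R} (\<lambda>x. f' x * cis (- (2 * pi * \<xi>) * x))"
    by (rule fourier_R_compact_support[OF bump_span_continuous[OF f(2)] R(5)])
  ultimately show ?thesis by simp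
qed

lemma fourier_R_norm_le: "cmod (fourier_R f \<xi>) \<le> (\<integral>x. cmod (f x) \<partial>lebesgue)"
  unfolding fourier_R_def by (rule order_trans[OF integral_norm_bound]) (simp add: norm_mult)

text \<open>Two derivatives turn into the factor (2 * pi * \<xi>)^2, so the L1 norms of f and of its
  second derivative together serve as \<open>K\<close>. Decay of this order makes the transform
  integrable and its integer translates uniformly summable.\<close>

lemma fourier_R_decay:
  assumes "f \<in> bump_span"
  obtains K where "0 \<le> K" "\<And>\<xi>. cmod (fourier_R f \<xi>) * (1 + \<xi>\<^sup>2) \<le> K"
proof -
  obtain f' where f': "f' \<in> bump_span" "\<And>x. (f has_vector_derivative f' x) (at x)"
    using bump_span_deriv[OF assms] by blast
  obtain f'' where f'': "f'' \<in> bump_span" "\<And>x. (f' has_vector_derivative f'' x) (at x)"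
    using bump_span_deriv[OF f'(1)] by blast
  let ?A = "\<integral>x. cmod (f x) \<partial>lebesgue" and ?B = "\<integral>x. cmod (f'' x) \<partial>lebesgue"
  have "cmod (fourier_R f \<xi>) * (1 + \<xi>\<^sup>2) \<le> ?A + ?B" for \<xi>
  proof -
    have "fourier_R f'' \<xi> = - (of_real ((2 * pi * \<xi>)\<^sup>2) * fourier_R f \<xi>)"
      unfolding fourier_R_deriv[OF f'(1) f''] fourier_R_deriv[OF assms f']
      by (simp add: power2_eq_square algebra_simps)
    then have "(2 * pi * \<xi>)\<^sup>2 * cmod (fourier_R f \<xi>) \<le> ?B"
      using fourier_R_norm_le[of f'' \<xi>] by (simp add: norm_mult norm_power power_mult_distrib)
    moreover have "1 * \<xi>\<^sup>2 \<le> (2 * pi)\<^sup>2 * \<xi>\<^sup>2"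
      using pi_gt3 by (intro mult_right_mono one_le_power) auto
    then have "\<xi>\<^sup>2 * cmod (fourier_R f \<xi>) \<le> (2 * pi * \<xi>)\<^sup>2 * cmod (fourier_R f \<xi>)"
      by (intro mult_right_mono) (auto simp: power_mult_distrib)
    ultimately show ?thesis using fourier_R_norm_le[of f \<xi>] by (simp add: algebra_simps)
  qed
  moreover have "0 \<le> ?A + ?B" by (intro add_nonneg_nonneg integral_nonneg_AE) auto
  ultimately show ?thesis using that by blast
qed

lemma borel_measurable_cis [measurable]: "cis \<in> borel_measurable borel"
  by (intro borel_measurable_continuous_onI continuous_intros)

lemma borel_measurable_cis_lebesgue: "(\<lambda>\<xi>. cis (s * \<xi>)) \<in> borel_measurable lebesgue"
  by (rule measurable_completion) simp

lemma fourier_R_measurable: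
  assumes "f \<in> bump_span"
  shows "fourier_R f \<in> borel_measurable lebesgue"
proof -
  have [measurable]: "f \<in> borel_measurable borel"
    by (rule borel_measurable_continuous_onI) (rule bump_span_continuous[OF assms(1)])
  have "fourier_R f \<xi> = (\<integral>x. f x * cis (- (2 * pi * \<xi> * x)) \<partial>lborel)" for \<xi>
    unfolding fourier_R_def by (rule integral_completion) measurable
  moreover have "(\<lambda>\<xi>. \<integral>x. f x * cis (- (2 * pi * \<xi> * x)) \<partial>lborel) \<in> borel_measurable borel"
    by measurable
  ultimately have "fourier_R f \<in> borel_measurable borel" by presburger
  then show ?thesis by (simp add: measurable_completion)
qed

lemma fourier_R_shift: "fourier_R (\<lambda>t. f (t + s)) \<xi> = cis (2 * pi * \<xi> * s) * fourier_R f \<xi>"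
proof -
  have "fourier_R (\<lambda>t. f (t + s)) \<xi> = (\<integral>t. f (- s + 1 * t + s) * cis (- (2 * pi * \<xi> * (- s + 1 * t))) \<partial>lebesgue)"
    unfolding fourier_R_def by (subst lebesgue_integral_real_affine[where c = 1 and t = "- s"]) auto
  also have "\<dots> = (\<integral>t. cis (2 * pi * \<xi> * s) * (f t * cis (- (2 * pi * \<xi> * t))) \<partial>lebesgue)"
    by (rule Bochner_Integration.integral_cong) (auto simp: cis_mult algebra_simps)
  finally show ?thesis by (simp add: fourier_R_def)
qed

lemma fourier_R_sum_bump:
  assumes "finite F"
  shows "fourier_R (\<lambda>t. \<Sum>j\<in>F. a j * bump (t + s j)) \<xi> = (\<Sum>j\<in>F. a j * cis (2 * pi * \<xi> * s j)) * fourier_R bump \<xi>"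
proof -
  have int: "integrable lebesgue (\<lambda>t. a j * bump (t + s j) * cis (- (2 * pi * \<xi> * t)))" for j
    using bump_span_integrable[OF bump_shift_in_span[of "a j" "s j"], of "- (2 * pi * \<xi>)"] by simp
  have "fourier_R (\<lambda>t. \<Sum>j\<in>F. a j * bump (t + s j)) \<xi> = (\<Sum>j\<in>F. \<integral>t. a j * bump (t + s j) * cis (- (2 * pi * \<xi> * t)) \<partial>lebesgue)"
    unfolding fourier_R_def sum_distrib_right by (rule Bochner_Integration.integral_sum) (rule int)
  also have "\<dots> = (\<Sum>j\<in>F. a j * fourier_R (\<lambda>t. bump (t + s j)) \<xi>)"
    unfolding fourier_R_def by (simp add: mult.assoc)
  finally show ?thesis by (simp add: fourier_R_shift sum_distrib_right mult.assoc)
qed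

text \<open>As \<open>bump\<close> vanishes outside the unit interval, its transform at \<xi> + n is
  a Fourier coefficient of a modulated bump on that interval, and the Fourier series converges at
  \<open>y\<close>. The modulation is normalised to 1 at t = y, so the limit does not depend on
  \<xi>; this constancy is what \<open>integral_periodic_mult\<close> asks of
  \<open>L\<close>.\<close>

lemma bump_Poisson:
  assumes y: "0 < y" "y < 1"
  shows "(\<lambda>N. \<Sum>n = - int N..int N. fourier_R bump (\<xi> + of_int n) * cis (2 * pi * (\<xi> + of_int n) * y)) \<longlonglongrightarrow> bump y"
proof -
  let ?h = "\<lambda>t. bump t * cis (- (2 * pi * \<xi> * (t - y)))"
  obtain b' where b': "\<And>x. (bump has_vector_derivative b' x) (at x)"
    using bump_span_deriv[OF bump_in_span] by blast
  have cb: "continuous_on S bump" for S by (rule bump_span_continuous[OF bump_in_span])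
  have "((\<lambda>t. cis (- (2 * pi * \<xi>) * t)) has_vector_derivative \<i> * of_real (- (2 * pi * \<xi>)) * cis (- (2 * pi * \<xi>) * y)) (at y)"
    by (rule has_vector_derivative_cis)
  then have D: "((\<lambda>t. cis (2 * pi * \<xi> * y) * (bump t * cis (- (2 * pi * \<xi>) * t))) has_vector_derivative
      cis (2 * pi * \<xi> * y) * (bump y * (\<i> * of_real (- (2 * pi * \<xi>)) * cis (- (2 * pi * \<xi>) * y)) + b' y * cis (- (2 * pi * \<xi>) * y))) (at y)"
    by (intro has_vector_derivative_mult_right has_vector_derivative_mult b')
  have eq: "(\<lambda>t. cis (2 * pi * \<xi> * y) * (bump t * cis (- (2 * pi * \<xi>) * t))) = ?h"
  proof
    fix t
    have "cis (- (2 * pi * \<xi> * (t - y))) = cis (2 * pi * \<xi> * y) * cis (- (2 * pi * \<xi>) * t)"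
      by (simp add: cis_mult algebra_simps)
    then show "cis (2 * pi * \<xi> * y) * (bump t * cis (- (2 * pi * \<xi>) * t)) = ?h t"
      by (simp add: mult.left_commute)
  qed
  from D have "(\<lambda>N. \<Sum>n = - int N..int N. integral {0..1} (\<lambda>t. ?h t * cis (- (2 * pi * of_int n * (t - y))))) \<longlonglongrightarrow> ?h y"
    unfolding eq by (rule Fourier_series_converges[rotated]) (auto intro!: continuous_intros cb y)
  moreover have "integral {0..1} (\<lambda>t. ?h t * cis (- (2 * pi * of_int n * (t - y)))) =
      fourier_R bump (\<xi> + of_int n) * cis (2 * pi * (\<xi> + of_int n) * y)" for n
  proof -
    have "fourier_R bump (\<xi> + of_int n) * cis (2 * pi * (\<xi> + of_int n) * y) =
        integral {0..1} (\<lambda>t. bump t * cis (- (2 * pi * (\<xi> + of_int n)) * t) * cis (2 * pi * (\<xi> + of_int n) * y))"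
      by (subst fourier_R_compact_support[OF cb, of 0 1]) (auto intro: bump_eq_0)
    also have "\<dots> = integral {0..1} (\<lambda>t. ?h t * cis (- (2 * pi * of_int n * (t - y))))"
    proof (rule integral_cong)
      fix t :: real
      have "cis (- (2 * pi * (\<xi> + of_int n)) * t) * cis (2 * pi * (\<xi> + of_int n) * y) =
          cis (- (2 * pi * \<xi> * (t - y))) * cis (- (2 * pi * of_int n * (t - y)))"
        by (simp add: cis_mult algebra_simps)
      then show "bump t * cis (- (2 * pi * (\<xi> + of_int n)) * t) * cis (2 * pi * (\<xi> + of_int n) * y) =
          ?h t * cis (- (2 * pi * of_int n * (t - y)))"
        by (simp only: mult.assoc)
    qed
    finally show ?thesis by simp
  qed
  ultimately show ?thesis by simp
qed

section \<open>Transference from the line to the integers\<close>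

lemma AE_lebesgue_shift:
  fixes c :: real
  assumes "AE x in lebesgue. P x"
  shows "AE x in lebesgue. P (x + c)"
proof -
  obtain N where N: "{x. \<not> P x} \<subseteq> N" "N \<in> null_sets lebesgue"
    using assms by (auto simp: eventually_ae_filter)
  have "(+) (- c) ` N \<in> null_sets lebesgue"
    using negligible_translation[of N "- c"] N(2) unfolding negligible_iff_null_sets by blast
  moreover have "{x. \<not> P (x + c)} \<subseteq> (+) (- c) ` N"
  proof
    fix x assume "x \<in> {x. \<not> P (x + c)}"
    then have "x + c \<in> N" using N(1) by auto
    then show "x \<in> (+) (- c) ` N" by (intro image_eqI[of _ _ "x + c"]) auto
  qed
  ultimately show ?thesis by (auto simp: eventually_ae_filter)
qed

lemma AE_periodic_int_shift:
  fixes G :: "real \<Rightarrow> complex"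
  assumes "AE \<xi> in lebesgue. G (\<xi> + 1) = G \<xi>"
  shows "AE \<xi> in lebesgue. G (\<xi> + of_int n) = G \<xi>"
proof -
  have nat: "AE \<xi> in lebesgue. G (\<xi> + real k) = G \<xi>" for k
  proof (induction k)
    case (Suc k)
    from Suc AE_lebesgue_shift[OF assms, of "real k"] show ?case
      by eventually_elim (simp add: algebra_simps)
  qed simp
  show ?thesis
  proof (cases "0 \<le> n")
    case True
    then show ?thesis using nat[of "nat n"] by simp
  next
    case False
    then show ?thesis using AE_lebesgue_shift[OF nat[of "nat (- n)"], of "of_int n"]
      by (simp add: eq_commute)
  qed
qed

lemma sum_inverse_square_bounded:
  obtains S where "\<And>N. (\<Sum>n = - int N..int N. 1 / (1 + (real_of_int n)\<^sup>2)) \<le> S"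
proof -
  let ?g = "\<lambda>n::nat. 1 / (1 + (real n)\<^sup>2)"
  have "summable ?g"
  proof (rule summable_comparison_test[OF _ inverse_power_summable[of 2]])
    show "\<exists>N. \<forall>n\<ge>N. norm (?g n) \<le> inverse (real n ^ 2)"
      by (intro exI[of _ 1] allI impI) (auto simp: divide_inverse intro!: le_imp_inverse_le)
  qed simp
  then have "(\<Sum>n\<le>N. ?g n) \<le> suminf ?g" for N by (intro sum_le_suminf) auto
  moreover have "(\<Sum>n = - int N..int N. 1 / (1 + (real_of_int n)\<^sup>2)) \<le> 2 * (\<Sum>n\<le>N. ?g n)" for N
  proof (induction N)
    case (Suc N)
    have "{- int (Suc N)..int (Suc N)} = insert (- int (Suc N)) (insert (int (Suc N)) {- int N..int N})"
      by auto
    then show ?case using Suc by (simp add: power2_eq_square algebra_simps)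
  qed simp
  ultimately have "(\<Sum>n = - int N..int N. 1 / (1 + (real_of_int n)\<^sup>2)) \<le> 2 * suminf ?g" for N
    by (meson mult_left_mono order_trans zero_le_numeral)
  then show ?thesis by (rule that)
qed

lemma integrable_inverse_one_plus_square_lebesgue:
  "integrable lebesgue (\<lambda>x::real. K / (1 + x\<^sup>2))"
proof -
  have "integrable lborel (\<lambda>x::real. inverse (1 + x\<^sup>2))"
    using integrable_inverse_1_plus_square by (simp add: set_integrable_def)
  then have "integrable lebesgue (\<lambda>x::real. inverse (1 + x\<^sup>2))"
    by (simp add: integrable_completion)
  then show ?thesis by (simp add: divide_inverse)
qed

text \<open>The line is cut into unit intervals and each piece is moved to [0,1), where periodicity
  of \<open>G\<close> leaves it unchanged and the translates of \<open>u\<close> add up to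
  \<open>L\<close>. Dominated convergence is used twice: on the line to exhaust it, and on [0,1) to
  sum the translates.\<close>

lemma integral_periodic_mult:
  fixes G u :: "real \<Rightarrow> complex"
  assumes G[measurable]: "G \<in> borel_measurable lebesgue" and B0: "0 \<le> B" and GB: "AE \<xi> in lebesgue. cmod (G \<xi>) \<le> B"
    and Gper: "AE \<xi> in lebesgue. G (\<xi> + 1) = G \<xi>"
    and u[measurable]: "u \<in> borel_measurable lebesgue" and uK: "\<And>\<xi>. cmod (u \<xi>) * (1 + \<xi>\<^sup>2) \<le> K"
    and usum: "\<And>\<xi>. (\<lambda>N. \<Sum>n = - int N..int N. u (\<xi> + of_int n)) \<longlonglongrightarrow> L"
  shows "(\<integral>\<xi>. G \<xi> * u \<xi> \<partial>lebesgue) = L * (\<integral>\<xi>. G \<xi> \<partial>lebesgue_on {0..<1})"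
proof -
  have sq: "0 < 1 + (x::real)\<^sup>2" for x by (simp add: add_pos_nonneg)
  have uK': "cmod (u \<xi>) \<le> K / (1 + \<xi>\<^sup>2)" for \<xi>
    using uK[of \<xi>] sq[of \<xi>] by (simp add: field_simps)
  have K0: "0 \<le> K" using uK[of 0] by (simp add: order_trans[OF norm_ge_zero])
  have GuB: "AE \<xi> in lebesgue. cmod (G \<xi> * u \<xi>) \<le> B * K / (1 + \<xi>\<^sup>2)"
    using GB
  proof eventually_elim
    case (elim \<xi>)
    have "cmod (G \<xi>) * cmod (u \<xi>) \<le> B * (K / (1 + \<xi>\<^sup>2))"
      by (rule mult_mono[OF elim uK' B0]) simp
    then show ?case by (simp add: norm_mult)
  qed
  have int: "integrable lebesgue (\<lambda>\<xi>. G \<xi> * u \<xi>)"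
    by (rule Bochner_Integration.integrable_bound[OF integrable_inverse_one_plus_square_lebesgue[of "B * K"]])
       (use GuB B0 K0 in \<open>auto elim!: eventually_mono simp: abs_mult\<close>)
  \<comment> \<open>The right end is N + 1 because the cells [n, n + 1) with |n| at most N fill
    exactly this interval, matching the symmetric sum.\<close>
  define I where "I N = {- real N..<real N + 1}" for N
  have meas_shift: "(\<lambda>\<xi>. u (\<xi> + of_int n)) \<in> borel_measurable lebesgue" for n
  proof -
    have "(\<lambda>\<xi>. real_of_int n + 1 * \<xi>) \<in> lebesgue \<rightarrow>\<^sub>M lebesgue"
      using lebesgue_affine_measurable[where c = "\<lambda>x::real. 1" and t = "of_int n"] by simp
    from measurable_compose[OF this u] show ?thesis by (simp add: add.commute)
  qed
  note [measurable] = meas_shift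
  have piece: "(\<integral>\<xi>. indicator {of_int n..<of_int n + 1} \<xi> *\<^sub>R (G \<xi> * u \<xi>) \<partial>lebesgue) =
      (\<integral>\<xi>. indicator {0..<1} \<xi> *\<^sub>R (G \<xi> * u (\<xi> + of_int n)) \<partial>lebesgue)"
    "integrable lebesgue (\<lambda>\<xi>. indicator {0..<1} \<xi> *\<^sub>R (G \<xi> * u (\<xi> + of_int n)))" for n
  proof -
    let ?f = "\<lambda>\<xi>. indicator {of_int n..<of_int n + 1} \<xi> *\<^sub>R (G \<xi> * u \<xi>)"
    let ?g = "\<lambda>\<xi>. indicator {0..<1} \<xi> *\<^sub>R (G \<xi> * u (\<xi> + of_int n))"
    have f: "integrable lebesgue ?f"
      by (rule integrable_mult_indicator[OF _ int]) simp
    have ae: "AE \<xi> in lebesgue. ?f (of_int n + 1 * \<xi>) = ?g \<xi>"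
      using AE_periodic_int_shift[OF Gper, of n]
      by eventually_elim (auto simp: indicator_def add.commute)
    have f': "integrable lebesgue (\<lambda>\<xi>. ?f (of_int n + 1 * \<xi>))"
      using f lebesgue_integrable_real_affine_iff[of 1 ?f "of_int n"] by simp
    have g: "?g \<in> borel_measurable lebesgue"
      by (intro borel_measurable_scaleR borel_measurable_indicator borel_measurable_times G meas_shift) auto
    show "integrable lebesgue ?g"
      by (rule integrable_cong_AE_imp[OF f']) (use ae g in \<open>auto simp: eq_commute\<close>)
    have "integral\<^sup>L lebesgue ?f = (\<integral>\<xi>. ?f (of_int n + 1 * \<xi>) \<partial>lebesgue)"
      using lebesgue_integral_real_affine[of 1 ?f "of_int n"] by simp
    also have "\<dots> = integral\<^sup>L lebesgue ?g"
      by (rule integral_cong_AE) (use borel_measurable_integrable[OF f'] g ae in auto)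
    finally show "integral\<^sup>L lebesgue ?f = integral\<^sup>L lebesgue ?g" .
  qed
  have ind: "indicator (I N) \<xi> = (\<Sum>n = - int N..int N. indicator {of_int n..<of_int n + 1} \<xi> :: real)" for N \<xi>
  proof -
    have eq: "indicator {of_int n..<of_int n + 1} \<xi> = (if n = \<lfloor>\<xi>\<rfloor> then 1 else 0 :: real)" for n
      by (auto simp: indicator_def floor_unique) 
    show ?thesis unfolding eq by (auto simp: I_def indicator_def le_floor_iff floor_less_iff) linarith+
  qed
  define D where "D N \<xi> = indicator {0..<1} \<xi> *\<^sub>R (G \<xi> * (\<Sum>n = - int N..int N. u (\<xi> + of_int n)))" for N \<xi>
  have trunc: "(\<integral>\<xi>. indicator (I N) \<xi> *\<^sub>R (G \<xi> * u \<xi>) \<partial>lebesgue) = (\<integral>\<xi>. D N \<xi> \<partial>lebesgue)" for N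
  proof -
    have "(\<integral>\<xi>. indicator (I N) \<xi> *\<^sub>R (G \<xi> * u \<xi>) \<partial>lebesgue) =
        (\<Sum>n = - int N..int N. \<integral>\<xi>. indicator {of_int n..<of_int n + 1} \<xi> *\<^sub>R (G \<xi> * u \<xi>) \<partial>lebesgue)"
      unfolding ind scaleR_sum_left
      by (rule Bochner_Integration.integral_sum) (rule integrable_mult_indicator[OF _ int], simp)
    also have "\<dots> = (\<integral>\<xi>. (\<Sum>n = - int N..int N. indicator {0..<1} \<xi> *\<^sub>R (G \<xi> * u (\<xi> + of_int n))) \<partial>lebesgue)"
      unfolding piece(1) by (rule Bochner_Integration.integral_sum[symmetric]) (rule piece(2))
    also have "\<dots> = (\<integral>\<xi>. D N \<xi> \<partial>lebesgue)"
      by (simp add: D_def sum_distrib_left scaleR_sum_right)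
    finally show ?thesis .
  qed
  have "(\<lambda>N. \<integral>\<xi>. indicator (I N) \<xi> *\<^sub>R (G \<xi> * u \<xi>) \<partial>lebesgue) \<longlonglongrightarrow> (\<integral>\<xi>. G \<xi> * u \<xi> \<partial>lebesgue)"
  proof (rule integral_dominated_convergence[where w = "\<lambda>\<xi>. cmod (G \<xi> * u \<xi>)"])
    show "integrable lebesgue (\<lambda>\<xi>. cmod (G \<xi> * u \<xi>))" using int by simp
    show "AE \<xi> in lebesgue. (\<lambda>N. indicator (I N) \<xi> *\<^sub>R (G \<xi> * u \<xi>)) \<longlonglongrightarrow> G \<xi> * u \<xi>"
    proof (rule AE_I2)
      fix \<xi> :: real
      have "\<forall>\<^sub>F N in sequentially. indicator (I N) \<xi> *\<^sub>R (G \<xi> * u \<xi>) = G \<xi> * u \<xi>"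
        by (rule eventually_sequentiallyI[of "nat \<lceil>\<bar>\<xi>\<bar>\<rceil>"]) (auto simp: I_def indicator_def nat_le_iff ceiling_le_iff)
      then show "(\<lambda>N. indicator (I N) \<xi> *\<^sub>R (G \<xi> * u \<xi>)) \<longlonglongrightarrow> G \<xi> * u \<xi>" by (rule tendsto_eventually)
    qed
    show "AE \<xi> in lebesgue. norm (indicator (I N) \<xi> *\<^sub>R (G \<xi> * u \<xi>)) \<le> cmod (G \<xi> * u \<xi>)" for N
      by (rule AE_I2) (auto simp: indicator_def)
  qed (auto simp: I_def intro!: borel_measurable_scaleR borel_measurable_indicator borel_measurable_times G u)
  then have lim1: "(\<lambda>N. \<integral>\<xi>. D N \<xi> \<partial>lebesgue) \<longlonglongrightarrow> (\<integral>\<xi>. G \<xi> * u \<xi> \<partial>lebesgue)"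
    unfolding trunc .
  obtain S where S: "\<And>N. (\<Sum>n = - int N..int N. 1 / (1 + (real_of_int n)\<^sup>2)) \<le> S"
    using sum_inverse_square_bounded by blast
  have sumB: "cmod (\<Sum>n = - int N..int N. u (\<xi> + of_int n)) \<le> 3 * K * S" if \<xi>: "\<xi> \<in> {0..<1}" for N \<xi>
  proof -
    have "cmod (u (\<xi> + of_int n)) \<le> 3 * K * (1 / (1 + (real_of_int n)\<^sup>2))" for n
    proof -
      \<comment> \<open>Expanded, this is n^2 \<le> 2 (\<xi> + n)^2 + 2 \<xi>^2, and with \<xi>^2
        \<le> 1 it gives the factor 3.\<close>
      have "0 \<le> (2 * \<xi> + of_int n)\<^sup>2" by simp
      moreover have "\<xi>\<^sup>2 \<le> 1" using \<xi> by (simp add: power_le_one)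
      ultimately have "1 + (real_of_int n)\<^sup>2 \<le> 3 * (1 + (\<xi> + of_int n)\<^sup>2)"
        by (simp add: power2_eq_square algebra_simps) (use sum_squares_ge_zero[of "of_int n + 2 * \<xi>" "of_int n + \<xi>"] in \<open>simp add: algebra_simps\<close>)
      then have "1 / (1 + (\<xi> + of_int n)\<^sup>2) \<le> 3 * (1 / (1 + (real_of_int n)\<^sup>2))"
        using sq[of "\<xi> + of_int n"] sq[of "of_int n"] by (simp add: field_simps)
      then have "K * (1 / (1 + (\<xi> + of_int n)\<^sup>2)) \<le> K * (3 * (1 / (1 + (real_of_int n)\<^sup>2)))"
        using K0 by (rule mult_left_mono)
      then show ?thesis using uK'[of "\<xi> + of_int n"] by (simp add: mult.commute[of K])
    qed
    then have "cmod (\<Sum>n = - int N..int N. u (\<xi> + of_int n)) \<le> (\<Sum>n = - int N..int N. 3 * K * (1 / (1 + (real_of_int n)\<^sup>2)))"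
      by (rule sum_norm_le)
    also have "\<dots> \<le> 3 * K * S"
      unfolding sum_distrib_left[symmetric] using S[of N] K0 by (intro mult_left_mono) auto
    finally show ?thesis .
  qed
  have "(\<lambda>N. \<integral>\<xi>. D N \<xi> \<partial>lebesgue) \<longlonglongrightarrow> (\<integral>\<xi>. indicator {0..<1} \<xi> *\<^sub>R (G \<xi> * L) \<partial>lebesgue)"
  proof (rule integral_dominated_convergence[where w = "\<lambda>\<xi>. indicator {0..<1} \<xi> *\<^sub>R (B * (3 * K * S))"])
    show "integrable lebesgue (\<lambda>\<xi>. indicator {0..<1::real} \<xi> *\<^sub>R (B * (3 * K * S)))"
      by (intro integrable_scaleR_left integrable_real_indicator) auto
    show "AE \<xi> in lebesgue. (\<lambda>N. D N \<xi>) \<longlonglongrightarrow> indicator {0..<1} \<xi> *\<^sub>R (G \<xi> * L)"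
      unfolding D_def by (intro AE_I2 tendsto_intros usum)
    show "AE \<xi> in lebesgue. norm (D N \<xi>) \<le> indicator {0..<1} \<xi> *\<^sub>R (B * (3 * K * S))" for N
      using GB
    proof eventually_elim
      case (elim \<xi>)
      show ?case
      proof (cases "\<xi> \<in> {0..<1}")
        case True
        have "cmod (G \<xi>) * cmod (\<Sum>n = - int N..int N. u (\<xi> + of_int n)) \<le> B * (3 * K * S)"
          by (rule mult_mono[OF elim sumB[OF True] B0]) simp
        then show ?thesis using True by (simp add: D_def norm_mult)
      qed (simp add: D_def)
    qed
  qed (auto simp: D_def intro!: borel_measurable_scaleR borel_measurable_indicator borel_measurable_times borel_measurable_sum G meas_shift)
  then have "(\<integral>\<xi>. G \<xi> * u \<xi> \<partial>lebesgue) = (\<integral>\<xi>. indicator {0..<1} \<xi> *\<^sub>R (G \<xi> * L) \<partial>lebesgue)"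
    using lim1 LIMSEQ_unique by blast
  also have "\<dots> = (\<integral>\<xi>. L * (indicator {0..<1} \<xi> *\<^sub>R G \<xi>) \<partial>lebesgue)"
    by (rule Bochner_Integration.integral_cong) auto
  also have "\<dots> = L * (\<integral>\<xi>. indicator {0..<1} \<xi> *\<^sub>R G \<xi> \<partial>lebesgue)"
    by (rule integral_mult_right_zero)
  also have "(\<integral>\<xi>. indicator {0..<1} \<xi> *\<^sub>R G \<xi> \<partial>lebesgue) = (\<integral>\<xi>. G \<xi> \<partial>lebesgue_on {0..<1})"
    by (rule integral_restrict_space[symmetric]) simp
  finally show ?thesis .
qed

section \<open>Circle multipliers as convolutions and their action on bumps\<close>

lemma Linfty_lebesgue_bound:
  assumes "m \<in> Linfty M"
  obtains B where "0 \<le> B" "AE x in M. norm (m x) \<le> B"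
proof -
  obtain B where "AE x in M. norm (m x) \<le> B" using assms by (auto simp: Linfty_def)
  then have "AE x in M. norm (m x) \<le> max 0 B" by eventually_elim simp
  then show ?thesis using that[of "max 0 B"] by simp
qed

lemma integrable_Linfty_circle:
  fixes m :: "real \<Rightarrow> complex"
  assumes m: "m \<in> Linfty lebesgue"
  shows "integrable (lebesgue_on {0..<1}) (\<lambda>\<xi>. m \<xi> * cis (s * \<xi>))"
proof -
  obtain B where B: "AE x in lebesgue. norm (m x) \<le> B" using Linfty_lebesgue_bound[OF m] by blast
  have [measurable]: "m \<in> borel_measurable lebesgue" using m by (simp add: Linfty_def)
  interpret finite_measure "lebesgue_on {0..<1::real}" 
    by (intro finite_measure_lebesgue_on bounded_set_imp_lmeasurable) auto
  have meas: "(\<lambda>\<xi>. m \<xi> * cis (s * \<xi>)) \<in> borel_measurable lebesgue"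
    by (intro borel_measurable_times borel_measurable_cis_lebesgue) measurable
  show ?thesis
  proof (rule integrable_const_bound[of _ B])
    have "AE x in lebesgue_on {0..<1}. norm (m x) \<le> B"
      using B by (subst AE_restrict_space_iff) auto
    then show "AE x in lebesgue_on {0..<1}. norm (m x * cis (s * x)) \<le> B"
      by eventually_elim (simp add: norm_mult)
    show "(\<lambda>\<xi>. m \<xi> * cis (s * \<xi>)) \<in> borel_measurable (lebesgue_on {0..<1})"
      by (rule measurable_restrict_space1[OF meas])
  qed
qed

text \<open>With the sign convention of \<open>fourier_Z\<close> this is the coefficient of
  \<open>m\<close> at frequency -k, that is, the convolution kernel of the multiplier operator on
  sequences.\<close>

definition mult_coeff :: "(real \<Rightarrow> complex) \<Rightarrow> int \<Rightarrow> complex" where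
  "mult_coeff m k = (\<integral>\<xi>. m \<xi> * cis (2 * pi * of_int k * \<xi>) \<partial>lebesgue_on {0..<1})"

lemma fourier_Z_finite:
  assumes "finite {j. a j \<noteq> 0}"
  shows "fourier_Z a \<xi> = (\<Sum>j | a j \<noteq> 0. a j * cis (- (2 * pi * of_int j * \<xi>)))"
proof -
  have "fourier_Z a \<xi> = (\<Sum>\<^sub>\<infinity>j\<in>{j. a j \<noteq> 0}. a j * cis (- (2 * pi * of_int j * \<xi>)))"
    unfolding fourier_Z_def by (rule infsum_cong_neutral) auto
  then show ?thesis using assms by simp
qed

lemma mult_op_Z_eq_conv_seq:
  assumes m: "m \<in> Linfty lebesgue" and a: "a \<in> finite_seqs"
  shows "mult_op_Z m a k = conv_seq (mult_coeff m) a k"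
proof -
  have fin: "finite {j. a j \<noteq> 0}" using a by (simp add: finite_seqs_def)
  have "m \<xi> * fourier_Z a \<xi> * cis (2 * pi * of_int k * \<xi>) =
      (\<Sum>j | a j \<noteq> 0. a j * (m \<xi> * cis (2 * pi * of_int (k - j) * \<xi>)))" for \<xi>
  proof -
    have "cis (2 * pi * of_int (k - j) * \<xi>) = cis (- (2 * pi * of_int j * \<xi>)) * cis (2 * pi * of_int k * \<xi>)" for j
      by (simp add: cis_mult algebra_simps)
    then show ?thesis
      unfolding fourier_Z_finite[OF fin] by (simp add: sum_distrib_left sum_distrib_right mult_ac)
  qed
  then have "mult_op_Z m a k = (\<integral>\<xi>. (\<Sum>j | a j \<noteq> 0. a j * (m \<xi> * cis (2 * pi * of_int (k - j) * \<xi>))) \<partial>lebesgue_on {0..<1})"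
    by (simp add: mult_op_Z_def)
  also have "\<dots> = (\<Sum>j | a j \<noteq> 0. \<integral>\<xi>. a j * (m \<xi> * cis (2 * pi * of_int (k - j) * \<xi>)) \<partial>lebesgue_on {0..<1})"
    by (intro Bochner_Integration.integral_sum integrable_mult_right integrable_Linfty_circle m)
  also have "\<dots> = conv_seq (mult_coeff m) a k"
    by (simp add: conv_seq_def mult_coeff_def)
  finally show ?thesis .
qed

lemma extends_with_bound_cong:
  assumes "\<And>f x. f \<in> D \<Longrightarrow> T f x = T' f x"
  shows "extends_with_bound p M D T C \<longleftrightarrow> extends_with_bound p M D T' C"
  unfolding extends_with_bound_def using assms by simp

lemma extends_with_bound_mult_op_Z_iff:
  assumes "1 \<le> p" "m \<in> Linfty lebesgue"
  shows "extends_with_bound p (count_space UNIV) finite_seqs (mult_op_Z m) C \<longleftrightarrow>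
    0 \<le> C \<and> conv_bound p (mult_coeff m) C"
  using extends_with_bound_cong[of finite_seqs "mult_op_Z m" "conv_seq (mult_coeff m)"]
    mult_op_Z_eq_conv_seq[OF assms(2)] extends_with_bound_conv_iff[OF assms(1)] by simp

text \<open>\<open>w\<close> itself need not be periodic, only its modulation. Translating the test
  function by \<open>x\<close> puts the missing factor \<open>cis (2 * pi * x * \<xi>)\<close> into
  its transform. The integrand then splits into the periodic \<open>?G\<close> and a transform of
  the bump whose integer translates sum to the constant \<open>bump y\<close>.\<close>

lemma mult_op_R_bump_sum:
  fixes w :: "real \<Rightarrow> complex"
  assumes w: "w \<in> borel_measurable lebesgue" and B: "0 \<le> B" "AE \<xi> in lebesgue. cmod (w \<xi>) \<le> B"
    and per: "AE \<xi> in lebesgue. cis (2 * pi * x * (\<xi> + 1)) * w (\<xi> + 1) = cis (2 * pi * x * \<xi>) * w \<xi>"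
    and a: "a \<in> finite_seqs" and y: "0 < y" "y < 1"
  shows "mult_op_R w (\<lambda>t. \<Sum>j | a j \<noteq> 0. a j * bump (t + (x - of_int j))) (of_int k + y) =
    bump y * mult_op_Z (\<lambda>\<xi>. cis (2 * pi * x * \<xi>) * w \<xi>) a k"
proof -
  have fin: "finite {j. a j \<noteq> 0}" using a by (simp add: finite_seqs_def)
  let ?m = "\<lambda>\<xi>. cis (2 * pi * x * \<xi>) * w \<xi>"
  let ?e = "\<lambda>\<xi>. fourier_Z a \<xi> * cis (2 * pi * of_int k * \<xi>)"
  let ?G = "\<lambda>\<xi>. ?m \<xi> * ?e \<xi>"
  let ?u = "\<lambda>\<xi>. fourier_R bump \<xi> * cis (2 * pi * \<xi> * y)"
  have cis_meas': "(\<lambda>\<xi>. cis (2 * pi * \<xi> * y)) \<in> borel_measurable lebesgue"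
    using borel_measurable_cis_lebesgue[of "2 * pi * y"] by (simp add: mult_ac)
  have fZ: "fourier_Z a \<xi> = (\<Sum>j | a j \<noteq> 0. a j * cis (- (2 * pi * of_int j) * \<xi>))" for \<xi>
    unfolding fourier_Z_finite[OF fin] by simp
  have e_per: "?e (\<xi> + 1) = ?e \<xi>" for \<xi>
  proof -
    have c: "cis (2 * pi * of_int n * (\<xi> + 1)) = cis (2 * pi * of_int n * \<xi>)" for n :: int
      by (simp add: distrib_left cis_mult[symmetric] cis_multiple_2pi)
    have c': "cis (- (2 * pi * of_int n) * (\<xi> + 1)) = cis (- (2 * pi * of_int n) * \<xi>)" for n :: int
      using c[of "- n"] by simp
    show ?thesis unfolding fZ c c' ..
  qed
  obtain K where K: "\<And>\<xi>. cmod (fourier_R bump \<xi>) * (1 + \<xi>\<^sup>2) \<le> K"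
    using fourier_R_decay[OF bump_in_span] by blast
  let ?A = "\<Sum>j | a j \<noteq> 0. cmod (a j)"
  have "mult_op_R w (\<lambda>t. \<Sum>j | a j \<noteq> 0. a j * bump (t + (x - of_int j))) (of_int k + y) = (\<integral>\<xi>. ?G \<xi> * ?u \<xi> \<partial>lebesgue)"
  proof -
    have "w \<xi> * fourier_R (\<lambda>t. \<Sum>j | a j \<noteq> 0. a j * bump (t + (x - of_int j))) \<xi> * cis (2 * pi * \<xi> * (of_int k + y)) = ?G \<xi> * ?u \<xi>" for \<xi>
    proof -
      have 1: "cis (2 * pi * \<xi> * (x - of_int j)) = cis (2 * pi * x * \<xi>) * cis (- (2 * pi * of_int j) * \<xi>)" for j
        by (simp add: cis_mult algebra_simps)
      have 2: "cis (2 * pi * \<xi> * (of_int k + y)) = cis (2 * pi * of_int k * \<xi>) * cis (2 * pi * \<xi> * y)"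
        by (simp add: cis_mult algebra_simps)
      have "(\<Sum>j | a j \<noteq> 0. a j * cis (2 * pi * \<xi> * (x - of_int j))) = cis (2 * pi * x * \<xi>) * fourier_Z a \<xi>"
        unfolding 1 fZ sum_distrib_left by (simp add: mult_ac)
      then show ?thesis unfolding fourier_R_sum_bump[OF fin] 2 by simp
    qed
    then show ?thesis by (simp only: mult_op_R_def inv_fourier_R_def)
  qed
  also have "\<dots> = bump y * (\<integral>\<xi>. ?G \<xi> \<partial>lebesgue_on {0..<1})"
  proof (rule integral_periodic_mult)
    show "?G \<in> borel_measurable lebesgue"
      unfolding fZ by (intro borel_measurable_times borel_measurable_sum w borel_measurable_cis_lebesgue borel_measurable_const)
    show "0 \<le> B * ?A" using B(1) by (intro mult_nonneg_nonneg sum_nonneg) auto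
    show "AE \<xi> in lebesgue. cmod (?G \<xi>) \<le> B * ?A"
      using B(2)
    proof eventually_elim
      case (elim \<xi>)
      have "cmod (fourier_Z a \<xi>) \<le> ?A"
        unfolding fZ by (rule order_trans[OF norm_sum]) (simp add: norm_mult)
      then have "cmod (w \<xi>) * cmod (fourier_Z a \<xi>) \<le> B * ?A"
        using elim B(1) by (intro mult_mono) auto
      then show ?case by (simp add: norm_mult)
    qed
    show "AE \<xi> in lebesgue. ?G (\<xi> + 1) = ?G \<xi>"
      using per by eventually_elim (simp only: e_per)
    show "?u \<in> borel_measurable lebesgue"
      by (intro borel_measurable_times fourier_R_measurable bump_in_span cis_meas')
    show "cmod (?u \<xi>) * (1 + \<xi>\<^sup>2) \<le> K" for \<xi> using K[of \<xi>] by (simp add: norm_mult)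
    show "(\<lambda>N. \<Sum>n = - int N..int N. ?u (\<xi> + of_int n)) \<longlonglongrightarrow> bump y" for \<xi>
      by (rule bump_Poisson[OF y])
  qed
  also have "(\<integral>\<xi>. ?G \<xi> \<partial>lebesgue_on {0..<1}) = mult_op_Z ?m a k"
    by (simp add: mult_op_Z_def mult.assoc)
  finally show ?thesis .
qed

section \<open>Comparison of norms through disjoint bumps\<close>

lemma bump_shift_nonzero_unique:
  assumes "bump (t - of_int i) \<noteq> 0" shows "i = \<lfloor>t\<rfloor>"
proof -
  have "0 < t - of_int i" "t - of_int i < 1"
    using assms bump_eq_0[of "t - of_int i"] by force+
  then show ?thesis by (intro floor_unique[symmetric]) auto
qed

lemma bump_sum_powr:
  assumes p: "0 < p" and F: "finite F"
  shows "cmod (\<Sum>j\<in>F. a j * bump (t - of_int j)) powr p = (\<Sum>j\<in>F. cmod (a j) powr p * cmod (bump (t - of_int j)) powr p)"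
proof -
  have z: "bump (t - of_int j) = 0" if "j \<noteq> \<lfloor>t\<rfloor>" for j
    using bump_shift_nonzero_unique[of t j] that by blast
  show ?thesis
  proof (cases "\<lfloor>t\<rfloor> \<in> F")
    case True
    have "(\<Sum>j\<in>F. a j * bump (t - of_int j)) = a \<lfloor>t\<rfloor> * bump (t - of_int \<lfloor>t\<rfloor>)"
      by (subst sum.remove[OF F True]) (auto intro!: sum.neutral simp: z)
    moreover have "(\<Sum>j\<in>F. cmod (a j) powr p * cmod (bump (t - of_int j)) powr p) =
        cmod (a \<lfloor>t\<rfloor>) powr p * cmod (bump (t - of_int \<lfloor>t\<rfloor>)) powr p"
      using p by (subst sum.remove[OF F True]) (auto intro!: sum.neutral simp: z)
    ultimately show ?thesis by (simp add: norm_mult powr_mult)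
  next
    case False
    then have "bump (t - of_int j) = 0" if "j \<in> F" for j using z[of j] that by metis
    then show ?thesis by simp
  qed
qed

lemma integral_bump_powr_pos:
  assumes "0 < p"
  shows "0 < (\<integral>t. cmod (bump t) powr p \<partial>lebesgue)"
proof -
  let ?f = "\<lambda>t. cmod (bump t) powr p"
  have int: "integrable lebesgue ?f" by (rule bump_span_powr_integrable[OF bump_in_span assms])
  have "(\<integral>t. ?f t \<partial>lebesgue) \<noteq> 0"
  proof
    assume "(\<integral>t. ?f t \<partial>lebesgue) = 0"
    then have "AE t in lebesgue. ?f t = 0"
      using integral_nonneg_eq_0_iff_AE[OF int] by simp
    then have "AE t in lebesgue. t \<notin> {0<..<1::real}"
      by eventually_elim (use bump_neq_0 in auto)
    then have "{0<..<1::real} \<in> null_sets lebesgue"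
      by (subst AE_iff_null_sets) auto
    then show False by (simp add: null_sets_completion_iff null_sets_def)
  qed
  moreover have "0 \<le> (\<integral>t. ?f t \<partial>lebesgue)" by (rule integral_nonneg_AE) simp
  ultimately show ?thesis by (metis order_less_le)
qed

text \<open>Input and output both consist of disjoint translates of the same bump, weighted by the
  entries of a sequence and of its convolution. The integral of the p-th power of the bump is
  therefore a common positive factor, and it cancels without any loss in \<open>C\<close>. The
  relation between \<open>m\<close> and \<open>w\<close> is only almost everywhere, since a
  periodization has an arbitrary value where its series diverges.\<close>

lemma conv_bound_transference:
  fixes w :: "real \<Rightarrow> complex"
  assumes p: "1 \<le> p" and w: "w \<in> Linfty lebesgue"
    and ext: "extends_with_bound p lebesgue schwartz (mult_op_R w) C"
    and m: "m \<in> Linfty lebesgue" "AE \<xi> in lebesgue. m \<xi> = cis (2 * pi * x * \<xi>) * w \<xi>"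
    and per: "AE \<xi> in lebesgue. m (\<xi> + 1) = m \<xi>"
  shows "conv_bound p (mult_coeff m) C"
  unfolding conv_bound_def
proof (intro ballI allI impI)
  fix a :: "int \<Rightarrow> complex" and K :: "int set"
  assume a: "a \<in> finite_seqs" and K: "finite K"
  have p0: "0 < p" using p by simp
  let ?F = "{j. a j \<noteq> 0}"
  have F: "finite ?F" using a by (simp add: finite_seqs_def)
  let ?m' = "\<lambda>\<xi>. cis (2 * pi * x * \<xi>) * w \<xi>"
  let ?I = "\<integral>t. cmod (bump t) powr p \<partial>lebesgue"
  define b where "b k = conv_seq (mult_coeff m) a k" for k
  define f where "f t = (\<Sum>j\<in>?F. a j * bump (t + (x - of_int j)))" for t
  obtain S where C: "0 \<le> C"
    and S: "\<And>f. f \<in> Lp p lebesgue \<Longrightarrow> S f \<in> Lp p lebesgue \<and> Lp_norm p lebesgue (S f) \<le> C * Lp_norm p lebesgue f"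
    and ST: "\<And>f. f \<in> schwartz \<Longrightarrow> AE t in lebesgue. S f t = mult_op_R w f t"
    using ext unfolding extends_with_bound_def by metis
  have f: "f \<in> bump_span"
    unfolding f_def by (rule sum_bump_in_span[OF F])
  have fLp: "f \<in> Lp p lebesgue" by (rule bump_span_in_Lp[OF f p0])
  obtain B where B: "0 \<le> B" "AE \<xi> in lebesgue. cmod (w \<xi>) \<le> B"
    using Linfty_lebesgue_bound[OF w] by blast
  have wm: "w \<in> borel_measurable lebesgue" using w by (simp add: Linfty_def)
  have per': "AE \<xi> in lebesgue. ?m' (\<xi> + 1) = ?m' \<xi>"
    using per m(2) AE_lebesgue_shift[OF m(2), of 1] by eventually_elim simp
  have b_eq: "b k = mult_op_Z ?m' a k" for k
  proof -
    have "mult_op_Z ?m' a k = mult_op_Z m a k"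
      unfolding mult_op_Z_def
    proof (rule integral_cong_AE)
      have fZ: "fourier_Z a \<xi> = (\<Sum>j | a j \<noteq> 0. a j * cis (- (2 * pi * of_int j) * \<xi>))" for \<xi>
        unfolding fourier_Z_finite[OF F] by simp
      have mm: "m \<in> borel_measurable lebesgue" using m(1) by (simp add: Linfty_def)
      show "(\<lambda>\<xi>. ?m' \<xi> * fourier_Z a \<xi> * cis (2 * pi * of_int k * \<xi>)) \<in> borel_measurable (lebesgue_on {0..<1})"
        "(\<lambda>\<xi>. m \<xi> * fourier_Z a \<xi> * cis (2 * pi * of_int k * \<xi>)) \<in> borel_measurable (lebesgue_on {0..<1})"
        unfolding fZ
        by (intro measurable_restrict_space1 borel_measurable_times borel_measurable_sum wm mm borel_measurable_cis_lebesgue borel_measurable_const)+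
      have "AE \<xi> in lebesgue_on {0..<1}. m \<xi> = ?m' \<xi>"
        using m(2) by (subst AE_restrict_space_iff) auto
      then show "AE \<xi> in lebesgue_on {0..<1}. ?m' \<xi> * fourier_Z a \<xi> * cis (2 * pi * of_int k * \<xi>) =
          m \<xi> * fourier_Z a \<xi> * cis (2 * pi * of_int k * \<xi>)"
        by eventually_elim simp
    qed
    then show ?thesis using mult_op_Z_eq_conv_seq[OF m(1) a] by (simp add: b_def)
  qed
  have shift_int: "(\<integral>t. cmod (bump (t + s)) powr p \<partial>lebesgue) = ?I" for s
    using lebesgue_integral_real_affine[of 1 "\<lambda>t. cmod (bump t) powr p" s] by (simp add: add.commute)
  have shift_integrable: "integrable lebesgue (\<lambda>t. cmod (bump (t + s)) powr p)" for s
    using bump_span_powr_integrable[OF bump_shift_in_span[of 1 s] p0] by simp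
  have f_int: "(\<integral>t. cmod (f t) powr p \<partial>lebesgue) = (\<Sum>j\<in>?F. cmod (a j) powr p) * ?I"
  proof -
    have "cmod (f t) powr p = (\<Sum>j\<in>?F. cmod (a j) powr p * cmod (bump (t + (x - of_int j))) powr p)" for t
      using bump_sum_powr[OF p0 F, of a "t + x"] by (simp add: f_def add_diff_eq)
    then have "(\<integral>t. cmod (f t) powr p \<partial>lebesgue) = (\<Sum>j\<in>?F. \<integral>t. cmod (a j) powr p * cmod (bump (t + (x - of_int j))) powr p \<partial>lebesgue)"
      by (simp only:) (intro Bochner_Integration.integral_sum integrable_mult_right shift_integrable)
    then show ?thesis by (simp add: shift_int sum_distrib_right)
  qed
  have Sint: "integrable lebesgue (\<lambda>t. cmod (S f t) powr p)" using S[OF fLp] by (simp add: Lp_def)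
  \<comment> \<open>Only the cells belonging to \<open>K\<close> are kept from the integral of the
    output; this matches the finite sums in \<open>conv_bound\<close>.\<close>
  have lower: "(\<Sum>k\<in>K. cmod (b k) powr p) * ?I \<le> (\<integral>t. cmod (S f t) powr p \<partial>lebesgue)"
  proof -
    have int: "integrable lebesgue (\<lambda>t. cmod (b k) powr p * cmod (bump (t - of_int k)) powr p)" for k
      using shift_integrable[of "- of_int k"] by simp
    have "(\<Sum>k\<in>K. cmod (b k) powr p) * ?I = (\<Sum>k\<in>K. \<integral>t. cmod (b k) powr p * cmod (bump (t - of_int k)) powr p \<partial>lebesgue)"
      using shift_int[of "- of_int _"] by (simp add: sum_distrib_right)
    also have "\<dots> = (\<integral>t. (\<Sum>k\<in>K. cmod (b k) powr p * cmod (bump (t - of_int k)) powr p) \<partial>lebesgue)"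
      by (rule Bochner_Integration.integral_sum[symmetric]) (rule int)
    also have "\<dots> \<le> (\<integral>t. cmod (S f t) powr p \<partial>lebesgue)"
    proof (rule integral_mono_AE)
      show "integrable lebesgue (\<lambda>t. \<Sum>k\<in>K. cmod (b k) powr p * cmod (bump (t - of_int k)) powr p)"
        by (intro Bochner_Integration.integrable_sum int)
      show "AE t in lebesgue. (\<Sum>k\<in>K. cmod (b k) powr p * cmod (bump (t - of_int k)) powr p) \<le> cmod (S f t) powr p"
        using ST[OF bump_span_schwartz[OF f]]
      proof eventually_elim
        case (elim t)
        show ?case
        \<comment> \<open>If the cell of \<open>t\<close> lies outside \<open>K\<close>, or
          \<open>t\<close> is a point where the bump vanishes, the left side is 0. Otherwise
          \<open>t\<close> is interior to its cell, as the Poisson formula requires.\<close>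
        proof (cases "\<lfloor>t\<rfloor> \<in> K \<and> bump (t - of_int \<lfloor>t\<rfloor>) \<noteq> 0")
          case True
          define y where "y = t - of_int \<lfloor>t\<rfloor>"
          have y: "0 < y" "y < 1" using True bump_eq_0[of y] by (force simp: y_def)+
          have "mult_op_R w f (of_int \<lfloor>t\<rfloor> + y) = bump y * b \<lfloor>t\<rfloor>"
            unfolding b_eq f_def[abs_def] by (rule mult_op_R_bump_sum[OF wm B per' a y])
          then have "cmod (S f t) powr p = cmod (b \<lfloor>t\<rfloor>) powr p * cmod (bump (t - of_int \<lfloor>t\<rfloor>)) powr p"
            using elim by (simp add: y_def norm_mult powr_mult mult.commute)
          moreover have "(\<Sum>k\<in>K. cmod (b k) powr p * cmod (bump (t - of_int k)) powr p) =
              cmod (b \<lfloor>t\<rfloor>) powr p * cmod (bump (t - of_int \<lfloor>t\<rfloor>)) powr p"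
          proof -
            have z: "bump (t - of_int k) = 0" if "k \<noteq> \<lfloor>t\<rfloor>" for k
              using bump_shift_nonzero_unique[of t k] that by blast
            show ?thesis
              using p0 True by (subst sum.remove[OF K, of "\<lfloor>t\<rfloor>"]) (auto intro!: sum.neutral simp: z)
          qed
          ultimately show ?thesis by simp
        next
          case False
          then have "bump (t - of_int k) = 0" if "k \<in> K" for k
            using that bump_shift_nonzero_unique[of t k] by metis
          then show ?thesis by simp
        qed
      qed
    qed (rule Sint)
    finally show ?thesis .
  qed
  have "(\<integral>t. cmod (S f t) powr p \<partial>lebesgue) \<le> C powr p * (\<integral>t. cmod (f t) powr p \<partial>lebesgue)"
    using S[OF fLp] powr_inverse_le_iff[of p] p C unfolding Lp_norm_def by auto
  with lower f_int have "(\<Sum>k\<in>K. cmod (b k) powr p) * ?I \<le> (C powr p * (\<Sum>j\<in>?F. cmod (a j) powr p)) * ?I"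
    by (simp add: mult.assoc)
  then show "(\<Sum>k\<in>K. cmod (conv_seq (mult_coeff m) a k) powr p) \<le> C powr p * (\<Sum>j\<in>?F. cmod (a j) powr p)"
    using integral_bump_powr_pos[OF p0] by (simp add: b_def)
qed

section \<open>Two multipliers on the circle\<close>

lemma circle_lmeasurable: "{0..<1::real} \<in> lmeasurable"
  by (intro bounded_set_imp_lmeasurable) auto

lemma lebesgue_shift_measurable:
  assumes "g \<in> borel_measurable lebesgue"
  shows "(\<lambda>y::real. g (y + c)) \<in> borel_measurable lebesgue"
proof -
  have "(\<lambda>\<xi>. c + 1 * \<xi>) \<in> lebesgue \<rightarrow>\<^sub>M lebesgue"
    using lebesgue_affine_measurable[where c = "\<lambda>x::real. 1" and t = c] by simp
  from measurable_compose[OF this assms] show ?thesis by (simp add: add.commute)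
qed

text \<open>Reduces rotations to translations of the line: with the function extended by 0, the two
  possible wrap-arounds are two translates, of which at most one is nonzero on [0,1).\<close>

lemma rotation_decomposition:
  fixes f :: "real \<Rightarrow> 'a::real_normed_vector"
  assumes y: "y \<in> {0..<1}"
  defines "g \<equiv> \<lambda>t. indicator {0..<1} t *\<^sub>R f t"
  shows "f (frac (y + s)) = g (y + frac s) + g (y + (frac s - 1))"
proof -
  have "frac y = y" using y by (simp add: frac_eq)
  then have frac: "frac (y + s) = (if y + frac s < 1 then y + frac s else y + frac s - 1)"
    using frac_add[of y s] by simp
  have "0 \<le> frac s" "frac s < 1" by (simp_all add: frac_lt_1)
  then show ?thesis
    unfolding frac g_def using y by (auto simp: indicator_def add_diff_eq)
qed

lemma circle_rotation_measurable:
  fixes f :: "real \<Rightarrow> 'a::euclidean_space"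
  assumes f: "f \<in> borel_measurable (lebesgue_on {0..<1})"
  shows "(\<lambda>y. f (frac (y + s))) \<in> borel_measurable (lebesgue_on {0..<1})"
proof -
  let ?g = "\<lambda>t. indicator {0..<1} t *\<^sub>R f t"
  have g: "?g \<in> borel_measurable lebesgue"
    using f by (subst (asm) borel_measurable_restrict_space_iff) auto
  have "(\<lambda>y. ?g (y + frac s) + ?g (y + (frac s - 1))) \<in> borel_measurable (lebesgue_on {0..<1})"
    by (intro measurable_restrict_space1 borel_measurable_add lebesgue_shift_measurable g)
  moreover have "?g (y + frac s) + ?g (y + (frac s - 1)) = f (frac (y + s))" if "y \<in> {0..<1}" for y
    using rotation_decomposition[OF that, of f s] by simp
  ultimately show ?thesis
    by (subst measurable_cong[of _ _ "\<lambda>y. ?g (y + frac s) + ?g (y + (frac s - 1))"]) auto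
qed

lemma circle_rotation_integral:
  fixes f :: "real \<Rightarrow> 'a::euclidean_space"
  assumes f: "integrable (lebesgue_on {0..<1}) f"
  shows "integrable (lebesgue_on {0..<1}) (\<lambda>y. f (frac (y + s)))" (is ?int)
    and "(\<integral>y. f (frac (y + s)) \<partial>lebesgue_on {0..<1}) = (\<integral>y. f y \<partial>lebesgue_on {0..<1})" (is ?eq)
proof -
  let ?g = "\<lambda>t. indicator {0..<1} t *\<^sub>R f t"
  let ?r = "frac s"
  let ?I = "\<lambda>t. indicator {0..<1} t :: real"
  have g: "integrable lebesgue ?g"
    using f by (subst (asm) integrable_restrict_space) auto
  have ind: "?I y *\<^sub>R f (frac (y + s)) = ?I y *\<^sub>R ?g (y + ?r) + ?I y *\<^sub>R ?g (y + (?r - 1))" for y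
  proof (cases "y \<in> {0..<1}")
    case True
    then show ?thesis using rotation_decomposition[OF True, of f s] by simp
  qed simp
  have piece: "integrable lebesgue (\<lambda>y. ?I y *\<^sub>R ?g (y + c))"
    "(\<integral>y. ?I y *\<^sub>R ?g (y + c) \<partial>lebesgue) = (\<integral>t. indicator {c..<1 + c} t *\<^sub>R ?g t \<partial>lebesgue)" for c
  proof -
    let ?h = "\<lambda>t. indicator {c..<1 + c} t *\<^sub>R ?g t"
    have eq: "?h (c + 1 * y) = ?I y *\<^sub>R ?g (y + c)" for y
      by (auto simp: indicator_def add.commute)
    have h: "integrable lebesgue ?h" by (rule integrable_mult_indicator[OF _ g]) simp
    show "integrable lebesgue (\<lambda>y. ?I y *\<^sub>R ?g (y + c))"
      using lebesgue_integrable_real_affine_iff[of 1 ?h c] h unfolding eq by simp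
    show "(\<integral>y. ?I y *\<^sub>R ?g (y + c) \<partial>lebesgue) = (\<integral>t. ?h t \<partial>lebesgue)"
      using lebesgue_integral_real_affine[of 1 ?h c] unfolding eq by simp
  qed
  show ?int
    by (subst integrable_restrict_space) (simp, subst ind, intro Bochner_Integration.integrable_add piece)
  have r: "0 \<le> ?r" "?r < 1" by (simp_all add: frac_lt_1)
  have h: "integrable lebesgue (\<lambda>t. indicator {c..<d} t *\<^sub>R ?g t)" for c d :: real
    by (rule integrable_mult_indicator[OF _ g]) simp
  have "(\<integral>y. f (frac (y + s)) \<partial>lebesgue_on {0..<1}) = (\<integral>y. ?I y *\<^sub>R f (frac (y + s)) \<partial>lebesgue)"
    by (rule integral_restrict_space) simp
  also have "\<dots> = (\<integral>t. indicator {?r..<1 + ?r} t *\<^sub>R ?g t \<partial>lebesgue) + (\<integral>t. indicator {?r - 1..<1 + (?r - 1)} t *\<^sub>R ?g t \<partial>lebesgue)"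
    unfolding ind by (subst Bochner_Integration.integral_add) (simp_all only: piece)
  also have "\<dots> = (\<integral>t. indicator {?r..<1 + ?r} t *\<^sub>R ?g t + indicator {?r - 1..<1 + (?r - 1)} t *\<^sub>R ?g t \<partial>lebesgue)"
    by (rule Bochner_Integration.integral_add[symmetric]) (rule h)+
  \<comment> \<open>The two windows are [r, 1 + r) and [r - 1, r): disjoint, and together covering
    [0,1), where \<open>?g\<close> lives.\<close>
  also have "\<dots> = (\<integral>t. ?g t \<partial>lebesgue)"
  proof (rule Bochner_Integration.integral_cong)
    show "indicator {?r..<1 + ?r} t *\<^sub>R ?g t + indicator {?r - 1..<1 + (?r - 1)} t *\<^sub>R ?g t = ?g t" for t
    proof (cases "t \<in> {0..<1}")
      case True
      then have "0 \<le> t" "t < 1" by auto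
      then have "t < 1 + ?r" "?r - 1 \<le> t" using r by linarith+
      with \<open>0 \<le> t\<close> \<open>t < 1\<close> show ?thesis by (cases "t < ?r") (simp_all add: indicator_def)
    qed simp
  qed simp
  also have "\<dots> = (\<integral>y. f y \<partial>lebesgue_on {0..<1})"
    by (rule integral_restrict_space[symmetric]) simp
  finally show ?eq .
qed

lemma integral_circle_cis:
  "(\<integral>x. cis (2 * pi * of_int n * x) \<partial>lebesgue_on {0..<1}) = (if n = 0 then 1 else 0)"
proof -
  have "(\<lambda>_. 1) \<in> Linfty lebesgue" by (auto simp: Linfty_def)
  from integrable_Linfty_circle[OF this]
  have "integrable (lebesgue_on {0..<1}) (\<lambda>x. cis (2 * pi * of_int n * x))" by simp
  then have "(\<integral>x. cis (2 * pi * of_int n * x) \<partial>lebesgue_on {0..<1}) = integral {0..<1} (\<lambda>x. cis (2 * pi * of_int n * x))"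
    by (rule lebesgue_integral_eq_integral) simp
  also have "\<dots> = integral {0..1} (\<lambda>x. cis (2 * pi * of_int n * x))"
    by (rule integral_spike_set) (auto intro: negligible_subset[OF negligible_sing[of 1]])
  finally show ?thesis by (simp add: integral_cis_int)
qed

lemma fourier_T_trig_poly:
  assumes F: "finite F"
  shows "fourier_T (\<lambda>x. \<Sum>m\<in>F. c m * cis (2 * pi * of_int m * x)) n = (if n \<in> F then c n else 0)"
proof -
  have one: "(\<lambda>_. 1) \<in> Linfty lebesgue" by (auto simp: Linfty_def)
  have "(\<Sum>m\<in>F. c m * cis (2 * pi * of_int m * x)) * cis (- (2 * pi * of_int n * x)) =
      (\<Sum>m\<in>F. c m * (1 * cis (2 * pi * of_int (m - n) * x)))" for x
    unfolding sum_distrib_right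
    by (rule sum.cong) (simp_all add: mult.assoc cis_mult algebra_simps)
  then have "fourier_T (\<lambda>x. \<Sum>m\<in>F. c m * cis (2 * pi * of_int m * x)) n =
      (\<integral>x. (\<Sum>m\<in>F. c m * (1 * cis (2 * pi * of_int (m - n) * x))) \<partial>lebesgue_on {0..<1})"
    by (simp only: fourier_T_def)
  also have "\<dots> = (\<Sum>m\<in>F. \<integral>x. c m * (1 * cis (2 * pi * of_int (m - n) * x)) \<partial>lebesgue_on {0..<1})"
    by (intro Bochner_Integration.integral_sum integrable_mult_right integrable_Linfty_circle one)
  also have "\<dots> = (\<Sum>m\<in>F. if m = n then c m else 0)"
    by (rule sum.cong) (simp_all add: integral_circle_cis del: of_int_diff)
  finally show ?thesis using F by simp
qed

lemma mult_op_T_trig_poly: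
  assumes F: "finite F"
  shows "mult_op_T \<phi> (\<lambda>x. \<Sum>m\<in>F. c m * cis (2 * pi * of_int m * x)) y =
    (\<Sum>n\<in>F. \<phi> n * c n * cis (2 * pi * of_int n * y))"
proof -
  have "mult_op_T \<phi> (\<lambda>x. \<Sum>m\<in>F. c m * cis (2 * pi * of_int m * x)) y =
      (\<Sum>\<^sub>\<infinity>n\<in>F. \<phi> n * c n * cis (2 * pi * of_int n * y))"
    unfolding mult_op_T_def fourier_T_trig_poly[OF F] by (rule infsum_cong_neutral) auto
  then show ?thesis using F by simp
qed

lemma cis_int_periodic: "cis (2 * pi * of_int n * (x + of_int k)) = cis (2 * pi * of_int n * x)"
proof -
  have "2 * pi * of_int n * (x + of_int k) = 2 * pi * of_int n * x + 2 * pi * of_int (n * k)"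
    by (simp add: algebra_simps)
  then show ?thesis by (simp add: cis_mult[symmetric] cis_multiple_2pi del: of_int_mult)
qed

lemma character_multiplier_bound:
  assumes p: "1 \<le> p"
  shows "extends_with_bound p (lebesgue_on {0..<1}) trig_polys (mult_op_T (\<lambda>n. cis (2 * pi * s * of_int n))) 1"
  unfolding extends_with_bound_def
proof (intro conjI exI[of _ "\<lambda>f y. f (frac (y + s))"] ballI allI)
  fix f :: "real \<Rightarrow> complex"
  assume f: "f \<in> Lp p (lebesgue_on {0..<1})"
  then have fm: "f \<in> borel_measurable (lebesgue_on {0..<1})"
    and fi: "integrable (lebesgue_on {0..<1}) (\<lambda>y. cmod (f y) powr p)" by (auto simp: Lp_def)
  show "(\<lambda>y. f (frac (y + s))) \<in> Lp p (lebesgue_on {0..<1})"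
    using circle_rotation_measurable[OF fm] circle_rotation_integral(1)[OF fi] by (simp add: Lp_def)
  show "Lp_norm p (lebesgue_on {0..<1}) (\<lambda>y. f (frac (y + s))) \<le> 1 * Lp_norm p (lebesgue_on {0..<1}) f"
    using circle_rotation_integral(2)[OF fi, of s] by (simp add: Lp_norm_def)
next
  fix f assume "f \<in> trig_polys"
  then obtain c F where F: "finite F" and f: "f = (\<lambda>x. \<Sum>n\<in>F. c n * cis (2 * pi * of_int n * x))"
    by (auto simp: trig_polys_def)
  have "f (frac (y + s)) = mult_op_T (\<lambda>n. cis (2 * pi * s * of_int n)) f y" for y
  proof -
    have "cis (2 * pi * of_int n * frac (y + s)) = cis (2 * pi * s * of_int n) * cis (2 * pi * of_int n * y)" for n
    proof -
      \<comment> \<open>The integer removed by \<open>frac\<close> is invisible to characters of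
        integer frequency.\<close>
      have "frac (y + s) = (y + s) + of_int (- \<lfloor>y + s\<rfloor>)" by (simp add: frac_def)
      then have "cis (2 * pi * of_int n * frac (y + s)) = cis (2 * pi * of_int n * (y + s))"
        by (simp only: cis_int_periodic)
      then show ?thesis by (simp add: cis_mult algebra_simps)
    qed
    then show ?thesis unfolding f mult_op_T_trig_poly[OF F] by (simp add: mult_ac)
  qed
  then show "AE y in lebesgue_on {0..<1}. f (frac (y + s)) = mult_op_T (\<lambda>n. cis (2 * pi * s * of_int n)) f y"
    by simp
qed auto

text \<open>In place of the Hoelder inequality, the elementary t \<le> l * (1 + (t / l) powr p) is
  integrated over the circle, which has measure 1. For \<open>l\<close> above the norm the result is
  at most 2 * l; this is the origin of the constant 2.\<close>

lemma Lp_circle_integrable: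
  assumes p: "1 \<le> p" and f: "f \<in> Lp p (lebesgue_on {0..<1::real})"
  shows "integrable (lebesgue_on {0..<1}) f"
    and "cmod (\<integral>x. f x \<partial>lebesgue_on {0..<1}) \<le> 2 * Lp_norm p (lebesgue_on {0..<1}) f"
proof -
  let ?M = "lebesgue_on {0..<1::real}"
  interpret finite_measure ?M by (rule finite_measure_lebesgue_on[OF circle_lmeasurable])
  have one: "measure ?M {0..<1} = 1"
    by (simp add: measure_restrict_space)
  have fm: "f \<in> borel_measurable ?M" and fi: "integrable ?M (\<lambda>y. cmod (f y) powr p)"
    using f by (auto simp: Lp_def)
  have bnd: "t \<le> l * (1 + t powr p / l powr p)" if "0 < l" "0 \<le> t" for l t :: real
  proof -
    have "t / l \<le> 1 + (t / l) powr p"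
    proof (cases "t / l \<le> 1")
      case True then show ?thesis using powr_ge_zero[of "t / l" p] by linarith
    next
      case False
      then have "(t / l) powr 1 \<le> (t / l) powr p" using p by (intro powr_mono) auto
      moreover have "(t / l) powr 1 = t / l" using that by (intro powr_one) simp
      ultimately show ?thesis by linarith
    qed
    then have "l * (t / l) \<le> l * (1 + (t / l) powr p)" using that by (intro mult_left_mono) auto
    then show ?thesis using that by (simp add: powr_divide)
  qed
  have int_dom: "integrable ?M (\<lambda>y. l * (1 + cmod (f y) powr p / l powr p))" for l
    by (intro integrable_mult_right Bochner_Integration.integrable_add integrable_const integrable_divide fi)
  show fint: "integrable ?M f"
    by (rule Bochner_Integration.integrable_bound[OF int_dom[of 1] fm])
       (use bnd[of 1] in \<open>auto simp: abs_of_nonneg add_nonneg_nonneg\<close>)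
  let ?A = "\<integral>y. cmod (f y) powr p \<partial>?M"
  have A0: "0 \<le> ?A" by (rule integral_nonneg_AE) simp
  \<comment> \<open>An \<open>l\<close> strictly above the norm is positive even for norm 0;
    afterwards \<open>l\<close> decreases to the norm.\<close>
  have "cmod (\<integral>x. f x \<partial>?M) \<le> 2 * l" if l: "Lp_norm p ?M f < l" for l
  proof -
    have l0: "0 < l" using l by (simp add: Lp_norm_def order_le_less_trans[OF powr_ge_zero])
    have "?A powr (1 / p) \<le> l * 1 powr (1 / p)" using l by (simp add: Lp_norm_def)
    then have Al: "?A \<le> l powr p" using powr_inverse_le_iff[of p ?A 1 l] p A0 l0 by simp
    have "cmod (\<integral>x. f x \<partial>?M) \<le> (\<integral>x. cmod (f x) \<partial>?M)" by (rule integral_norm_bound)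
    also have "\<dots> \<le> (\<integral>y. l * (1 + cmod (f y) powr p / l powr p) \<partial>?M)"
      using fint int_dom by (intro integral_mono) (auto intro: bnd[OF l0])
    also have "\<dots> = l * (1 + ?A / l powr p)"
      using fi one by (simp add: Bochner_Integration.integral_add)
    also have "\<dots> \<le> l * (1 + 1)"
      using Al l0 by (intro mult_left_mono add_left_mono) (auto simp: divide_simps)
    finally show ?thesis by simp
  qed
  then have "cmod (\<integral>x. f x \<partial>?M) / 2 \<le> l" if "Lp_norm p ?M f < l" for l using that by fastforce
  then have "cmod (\<integral>x. f x \<partial>?M) / 2 \<le> Lp_norm p ?M f" by (rule dense_ge)
  then show "cmod (\<integral>x. f x \<partial>?M) \<le> 2 * Lp_norm p ?M f" by simp
qed

text \<open>The extension is the mean value, viewed as a constant function. Any finite constant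
  serves, as this is only used to place the multiplier in \<open>M_Z\<close>.\<close>

lemma delta_multiplier_bound:
  assumes p: "1 \<le> p"
  shows "extends_with_bound p (lebesgue_on {0..<1}) trig_polys (mult_op_T (\<lambda>n. if n = 0 then 1 else 0)) 2"
  unfolding extends_with_bound_def
proof (intro conjI exI[of _ "\<lambda>f y. \<integral>x. f x \<partial>lebesgue_on {0..<1}"] ballI allI)
  let ?M = "lebesgue_on {0..<1::real}"
  interpret finite_measure ?M by (rule finite_measure_lebesgue_on[OF circle_lmeasurable])
  have one: "measure ?M {0..<1} = 1"
    by (simp add: measure_restrict_space)
  fix f assume f: "f \<in> Lp p ?M"
  show "(\<lambda>y. \<integral>x. f x \<partial>?M) \<in> Lp p ?M" by (simp add: Lp_def)
  have "Lp_norm p ?M (\<lambda>y. \<integral>x. f x \<partial>?M) = cmod (\<integral>x. f x \<partial>?M)"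
    using p one by (simp add: Lp_norm_def powr_powr)
  then show "Lp_norm p ?M (\<lambda>y. \<integral>x. f x \<partial>?M) \<le> 2 * Lp_norm p ?M f"
    using Lp_circle_integrable(2)[OF p f] by simp
next
  fix f assume "f \<in> trig_polys"
  have "mult_op_T (\<lambda>n. if n = 0 then 1 else 0) f y = (\<integral>x. f x \<partial>lebesgue_on {0..<1})" for y
  proof -
    have "mult_op_T (\<lambda>n. if n = 0 then 1 else 0) f y = (\<Sum>\<^sub>\<infinity>n\<in>{0}. fourier_T f n)"
      unfolding mult_op_T_def by (rule infsum_cong_neutral) auto
    then show ?thesis by (simp add: fourier_T_def)
  qed
  then show "AE y in lebesgue_on {0..<1}. (\<integral>x. f x \<partial>lebesgue_on {0..<1}) = mult_op_T (\<lambda>n. if n = 0 then 1 else 0) f y"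
    by simp
qed (use Lp_circle_integrable(1)[OF p] in auto)

lemma character_in_M_Z:
  assumes "1 \<le> p"
  shows "(\<lambda>n. cis (2 * pi * s * of_int n)) \<in> M_Z p" "norm_M_Z p (\<lambda>n. cis (2 * pi * s * of_int n)) \<le> 1"
    "0 \<le> norm_M_Z p (\<lambda>n. cis (2 * pi * s * of_int n))"
proof -
  let ?S = "{C. extends_with_bound p (lebesgue_on {0..<1}) trig_polys (mult_op_T (\<lambda>n. cis (2 * pi * s * of_int n))) C}"
  have 1: "1 \<in> ?S" using character_multiplier_bound[OF assms] by simp
  have 0: "0 \<le> C" if "C \<in> ?S" for C using that by (simp add: extends_with_bound_def)
  have "bounded (range (\<lambda>n. cis (2 * pi * s * of_int n)))"
    unfolding bounded_iff by (intro exI[of _ 1]) auto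
  with 1 show "(\<lambda>n. cis (2 * pi * s * of_int n)) \<in> M_Z p" by (auto simp: M_Z_def)
  show "norm_M_Z p (\<lambda>n. cis (2 * pi * s * of_int n)) \<le> 1"
    unfolding norm_M_Z_def extension_norm_def by (rule cInf_lower[OF 1 bdd_belowI[OF 0]])
  show "0 \<le> norm_M_Z p (\<lambda>n. cis (2 * pi * s * of_int n))"
    unfolding norm_M_Z_def extension_norm_def by (rule cInf_greatest) (use 0 1 in blast)+
qed

lemma delta_in_M_Z:
  assumes "1 \<le> p"
  shows "(\<lambda>n. if n = 0 then 1 else 0) \<in> M_Z p"
proof -
  have "bounded (range (\<lambda>n::int. if n = 0 then 1 else 0 :: complex))"
    unfolding bounded_iff by (intro exI[of _ 1]) auto
  then show ?thesis using delta_multiplier_bound[OF assms] by (auto simp: M_Z_def)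
qed

section \<open>Summability kernels\<close>

lemma convergent_symm_sum_imp_tendsto:
  assumes "convergent (symm_sum a)"
  shows "(\<lambda>N. a (int N) + a (- int N)) \<longlonglongrightarrow> 0"
proof -
  obtain L where L: "symm_sum a \<longlonglongrightarrow> L" using assms by (auto simp: convergent_def)
  have "symm_sum a (Suc N) - symm_sum a N = a (int (Suc N)) + a (- int (Suc N))" for N
  proof -
    have "{- int (Suc N)..int (Suc N)} = insert (- int (Suc N)) (insert (int (Suc N)) {- int N..int N})"
      by auto
    then show ?thesis by (simp add: symm_sum_def)
  qed
  then have "(\<lambda>N. a (int (Suc N)) + a (- int (Suc N))) \<longlonglongrightarrow> L - L"
    using tendsto_diff[OF LIMSEQ_Suc[OF L] L] by simp
  then have "(\<lambda>N. a (int (Suc N)) + a (- int (Suc N))) \<longlonglongrightarrow> 0" by simp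
  then show ?thesis by (rule LIMSEQ_imp_Suc)
qed

text \<open>Symmetric convergence only controls \<open>a N + a (- N)\<close>. Multiplying by the character
  \<open>\<i> ^ n\<close> turns this into \<open>a N + (-1) ^ N * a (- N)\<close>, so odd \<open>N\<close> are controlled, and the shifted
  sequence takes care of even \<open>N\<close>.\<close>

lemma symm_sum_characters_decay:
  assumes a: "convergent (symm_sum a)" "convergent (symm_sum (\<lambda>n. cis (pi / 2 * of_int n) * a n))"
    and b: "convergent (symm_sum (\<lambda>n. a (n - 1)))" "convergent (symm_sum (\<lambda>n. cis (pi / 2 * of_int n) * a (n - 1)))"
  shows "(\<lambda>N. a (int N)) \<longlonglongrightarrow> 0" "(\<lambda>N. a (- int N)) \<longlonglongrightarrow> 0"
proof -
  have odd: "(\<lambda>N. (1 - (-1) ^ N) * c (int N)) \<longlonglongrightarrow> 0"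
    if c: "convergent (symm_sum c)" "convergent (symm_sum (\<lambda>n. cis (pi / 2 * of_int n) * c n))" for c
  proof -
    have "(\<lambda>N. cis (pi / 2 * real N) * (cis (pi / 2 * real N) * c (int N) + cis (- (pi / 2 * real N)) * c (- int N))) \<longlonglongrightarrow> 0"
      by (rule Lim_null_comparison[OF _ tendsto_norm_zero[OF convergent_symm_sum_imp_tendsto[OF c(2)]]])
         (simp add: norm_mult)
    moreover have "cis (pi / 2 * real N) * (cis (pi / 2 * real N) * c (int N) + cis (- (pi / 2 * real N)) * c (- int N)) =
        (-1) ^ N * c (int N) + c (- int N)" for N
    proof -
      have "cis (pi / 2 * real N) * cis (pi / 2 * real N) = cis pi ^ N"
        unfolding cis_mult Complex.DeMoivre by (simp add: mult.commute)
      then have e: "cis (pi / 2 * real N) * cis (pi / 2 * real N) = (-1) ^ N" by (simp add: cis_pi)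
      have e': "cis (pi / 2 * real N) * cis (- (pi / 2 * real N)) = 1" by (simp add: cis_mult)
      show ?thesis unfolding distrib_left mult.assoc[symmetric] e e' by simp
    qed
    ultimately have "(\<lambda>N. (-1) ^ N * c (int N) + c (- int N)) \<longlonglongrightarrow> 0" by simp
    from tendsto_diff[OF convergent_symm_sum_imp_tendsto[OF c(1)] this]
    show ?thesis by (simp add: algebra_simps)
  qed
  \<comment> \<open>The shifted sequence at index N + 1 has entry a N with weight 1 + (-1)^N. Adding
    the weight 1 - (-1)^N of the unshifted one leaves 2 * a N for every parity.\<close>
  have "(\<lambda>N. (1 - (-1) ^ Suc N) * a (int (Suc N) - 1)) \<longlonglongrightarrow> 0"
    using LIMSEQ_Suc[OF odd[OF b]] .
  then have "(\<lambda>N. (1 + (-1) ^ N) * a (int N)) \<longlonglongrightarrow> 0" by simp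
  from tendsto_add[OF odd[OF a] this] have "(\<lambda>N. 2 * a (int N)) \<longlonglongrightarrow> 0"
    by (simp add: algebra_simps)
  then show lim: "(\<lambda>N. a (int N)) \<longlonglongrightarrow> 0"
    using tendsto_mult_left[of "\<lambda>N. 2 * a (int N)" 0 sequentially "1 / 2"] by simp
  from tendsto_diff[OF convergent_symm_sum_imp_tendsto[OF a(1)] lim]
  show "(\<lambda>N. a (- int N)) \<longlonglongrightarrow> 0" by simp
qed

text \<open>The kernel series runs over \<xi> - n and the periodization over \<xi> + n. Reflecting
  the symmetric range replaces n by -n, which is why the character carries -x.\<close>

lemma symm_sum_modulate:
  "symm_sum (\<lambda>n. modulate x \<Lambda> (\<xi> + of_int n)) N =
   cis (2 * pi * x * \<xi>) * symm_sum (\<lambda>n. cis (2 * pi * (- x) * of_int n) * \<Lambda> (\<xi> - of_int n)) N"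
proof -
  have "modulate x \<Lambda> (\<xi> + of_int n) =
      cis (2 * pi * x * \<xi>) * (cis (2 * pi * (- x) * of_int (- n)) * \<Lambda> (\<xi> - of_int (- n)))" for n
    unfolding modulate_def mult.assoc[symmetric] cis_mult by (simp add: algebra_simps)
  then have "symm_sum (\<lambda>n. modulate x \<Lambda> (\<xi> + of_int n)) N =
      (\<Sum>n = - int N..int N. cis (2 * pi * x * \<xi>) * (cis (2 * pi * (- x) * of_int (- n)) * \<Lambda> (\<xi> - of_int (- n))))"
    by (simp only: symm_sum_def)
  also have "\<dots> = (\<Sum>n = - int N..int N. cis (2 * pi * x * \<xi>) * (cis (2 * pi * (- x) * of_int n) * \<Lambda> (\<xi> - of_int n)))"
    by (rule sum.reindex_bij_witness[of _ uminus uminus]) auto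
  finally show ?thesis by (simp add: symm_sum_def sum_distrib_left)
qed

text \<open>Isolates the two boundary terms that separate a symmetric partial sum from its shift by
  one period.\<close>

lemma symm_sum_shift:
  "symm_sum (\<lambda>n. g (\<xi> + 1 + of_int n)) N =
   symm_sum (\<lambda>n. g (\<xi> + of_int n)) N + (g (\<xi> + of_int (int N + 1)) - g (\<xi> - real N))"
proof -
  have "symm_sum (\<lambda>n. g (\<xi> + 1 + of_int n)) N = (\<Sum>n = - int N + 1..int N + 1. g (\<xi> + of_int n))"
    unfolding symm_sum_def
    by (rule sum.reindex_bij_witness[of _ "\<lambda>n. n - 1" "\<lambda>n. n + 1"]) (auto simp: algebra_simps)
  moreover have "{- int N..int N + 1} = insert (- int N) {- int N + 1..int N + 1}"
    "{- int N..int N + 1} = insert (int N + 1) {- int N..int N}" by auto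
  then have "g (\<xi> - real N) + (\<Sum>n = - int N + 1..int N + 1. g (\<xi> + of_int n)) =
      g (\<xi> + of_int (int N + 1)) + (\<Sum>n = - int N..int N. g (\<xi> + of_int n))"
    using sum.insert[of "{- int N + 1..int N + 1}" "- int N" "\<lambda>n. g (\<xi> + of_int n)"]
      sum.insert[of "{- int N..int N}" "int N + 1" "\<lambda>n. g (\<xi> + of_int n)"] by simp
  ultimately show ?thesis by (simp add: symm_sum_def algebra_simps)
qed

section \<open>Measurability in the modulation parameter\<close>

lemma complex_borel_representative:
  fixes f :: "'a::euclidean_space \<Rightarrow> complex"
  assumes f: "f \<in> borel_measurable lebesgue"
  obtains f' where "f' \<in> borel_measurable borel" "AE x in lebesgue. f x = f' x"
proof -
  have "(\<lambda>x. Re (f x)) \<in> borel_measurable lebesgue" "(\<lambda>x. Im (f x)) \<in> borel_measurable lebesgue"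
    using f by measurable
  then obtain r i where r: "r \<in> borel_measurable lborel" "AE x in lborel. Re (f x) = r x"
    and i: "i \<in> borel_measurable lborel" "AE x in lborel. Im (f x) = i x"
    using completion_ex_borel_measurable_real by metis
  have "(\<lambda>x. Complex (r x) (i x)) \<in> borel_measurable borel"
    using r(1) i(1) by (simp add: borel_measurable_complex_iff)
  moreover have "AE x in lborel. f x = Complex (r x) (i x)"
    using r(2) i(2) by eventually_elim (simp add: complex_eq_iff)
  then have "AE x in lebesgue. f x = Complex (r x) (i x)" by (rule AE_completion)
  ultimately show ?thesis by (rule that)
qed

lemma periodization_measurable:
  assumes "\<Lambda> \<in> borel_measurable lebesgue"
  shows "periodization (modulate x \<Lambda>) \<in> borel_measurable lebesgue"
proof -
  have m: "modulate x \<Lambda> \<in> borel_measurable lebesgue"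
    unfolding modulate_def[abs_def]
    by (intro borel_measurable_times borel_measurable_cis_lebesgue assms)
  show ?thesis
    unfolding periodization_def[abs_def] symm_sum_def
    by (intro borel_measurable_lim_metric borel_measurable_sum lebesgue_shift_measurable m)
qed

text \<open>Measurability of the parameter integral rests on joint Borel measurability in x and
  \<xi>, so \<Lambda> is replaced by a Borel representative. Almost every \<xi> has the two
  functions equal at all its integer translates; there the two series coincide term by term, and so
  do their periodizations, convergent or not.\<close>

lemma mult_coeff_periodization_measurable:
  assumes \<Lambda>: "\<Lambda> \<in> borel_measurable lebesgue"
  shows "(\<lambda>x. mult_coeff (periodization (modulate x \<Lambda>)) k) \<in> borel_measurable borel"
proof -
  obtain \<Lambda>' where \<Lambda>'[measurable]: "\<Lambda>' \<in> borel_measurable borel" and ae: "AE \<xi> in lebesgue. \<Lambda> \<xi> = \<Lambda>' \<xi>"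
    using complex_borel_representative[OF \<Lambda>] by blast
  have ae': "AE \<xi> in lebesgue. \<forall>n::int. \<Lambda> (\<xi> + of_int n) = \<Lambda>' (\<xi> + of_int n)"
    unfolding AE_all_countable using AE_lebesgue_shift[OF ae] by blast
  have eq: "mult_coeff (periodization (modulate x \<Lambda>)) k =
     (\<integral>\<xi>. indicator {0..<1} \<xi> *\<^sub>R (periodization (modulate x \<Lambda>') \<xi> * cis (2 * pi * of_int k * \<xi>)) \<partial>lborel)" for x
  proof -
    have \<Lambda>'_leb: "\<Lambda>' \<in> borel_measurable lebesgue"
      by (rule measurable_completion) simp
    have "mult_coeff (periodization (modulate x \<Lambda>)) k =
        (\<integral>\<xi>. indicator {0..<1} \<xi> *\<^sub>R (periodization (modulate x \<Lambda>) \<xi> * cis (2 * pi * of_int k * \<xi>)) \<partial>lebesgue)"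
      unfolding mult_coeff_def by (rule integral_restrict_space) simp
    also have "\<dots> = (\<integral>\<xi>. indicator {0..<1} \<xi> *\<^sub>R (periodization (modulate x \<Lambda>') \<xi> * cis (2 * pi * of_int k * \<xi>)) \<partial>lebesgue)"
    proof (rule integral_cong_AE)
      show "AE \<xi> in lebesgue. indicator {0..<1} \<xi> *\<^sub>R (periodization (modulate x \<Lambda>) \<xi> * cis (2 * pi * of_int k * \<xi>)) =
          indicator {0..<1} \<xi> *\<^sub>R (periodization (modulate x \<Lambda>') \<xi> * cis (2 * pi * of_int k * \<xi>))"
        using ae' by eventually_elim (simp add: periodization_def modulate_def)
    qed (auto intro!: borel_measurable_scaleR borel_measurable_indicator borel_measurable_times
           periodization_measurable \<Lambda> \<Lambda>'_leb borel_measurable_cis_lebesgue)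
    also have "\<dots> = (\<integral>\<xi>. indicator {0..<1} \<xi> *\<^sub>R (periodization (modulate x \<Lambda>') \<xi> * cis (2 * pi * of_int k * \<xi>)) \<partial>lborel)"
      unfolding periodization_def symm_sum_def modulate_def by (rule integral_completion) measurable
    finally show ?thesis .
  qed
  show ?thesis
    unfolding eq periodization_def symm_sum_def modulate_def by measurable
qed

lemma kernel_bounds:
  assumes p: "1 \<le> p" and \<Lambda>: "\<Lambda> \<in> summability_kernels p"
  obtains K where "0 \<le> K"
    "\<And>s. AE \<xi> in lebesgue. convergent (symm_sum (\<lambda>n. cis (2 * pi * s * of_int n) * \<Lambda> (\<xi> - of_int n)))"
    "\<And>s. W (\<lambda>n. cis (2 * pi * s * of_int n)) \<Lambda> \<in> Linfty lebesgue"
    "\<And>s. \<exists>C\<le>K. extends_with_bound p lebesgue schwartz (mult_op_R (W (\<lambda>n. cis (2 * pi * s * of_int n)) \<Lambda>)) C"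
proof -
  let ?c = "\<lambda>s n. cis (2 * pi * s * real_of_int n)"
  obtain C where C: "\<And>\<phi>. \<phi> \<in> M_Z p \<Longrightarrow> norm_M_R p (W \<phi> \<Lambda>) \<le> C * norm_M_Z p \<phi>"
    using \<Lambda> by (auto simp: summability_kernels_def)
  have MR: "W (?c s) \<Lambda> \<in> M_R p" for s
    using \<Lambda> character_in_M_Z(1)[OF p, of s] by (auto simp: summability_kernels_def)
  \<comment> \<open>The sign of \<open>C\<close> is unknown, hence the absolute value. The extra 1
    makes the inequality for the infimum strict, so an actual admissible constant can be picked
    below it.\<close>
  have "\<exists>C'\<le>\<bar>C\<bar> + 1. extends_with_bound p lebesgue schwartz (mult_op_R (W (?c s) \<Lambda>)) C'" for s
  proof -
    have ne: "{C. extends_with_bound p lebesgue schwartz (mult_op_R (W (?c s) \<Lambda>)) C} \<noteq> {}"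
      using MR[of s] by (auto simp: M_R_def)
    have "norm_M_R p (W (?c s) \<Lambda>) \<le> C * norm_M_Z p (?c s)"
      by (rule C[OF character_in_M_Z(1)[OF p]])
    also have "\<dots> \<le> \<bar>C\<bar> * 1"
      by (rule mult_mono) (use character_in_M_Z[OF p, of s] in auto)
    finally have "Inf {C. extends_with_bound p lebesgue schwartz (mult_op_R (W (?c s) \<Lambda>)) C} < \<bar>C\<bar> + 1"
      by (simp add: norm_M_R_def extension_norm_def)
    from cInf_lessD[OF ne this] show ?thesis by (auto intro: less_imp_le)
  qed
  moreover have "AE \<xi> in lebesgue. convergent (symm_sum (\<lambda>n. ?c s n * \<Lambda> (\<xi> - of_int n)))" for s
    using \<Lambda> character_in_M_Z(1)[OF p, of s] by (auto simp: summability_kernels_def)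
  moreover have "W (?c s) \<Lambda> \<in> Linfty lebesgue" for s using MR[of s] by (simp add: M_R_def)
  ultimately show ?thesis using that[of "\<bar>C\<bar> + 1"] by simp
qed

lemma kernel_Linfty:
  assumes p: "1 \<le> p" and \<Lambda>: "\<Lambda> \<in> summability_kernels p"
  shows "\<Lambda> \<in> Linfty lebesgue"
proof -
  let ?\<delta> = "\<lambda>n::int. if n = 0 then 1 else 0 :: complex"
  have "symm_sum (\<lambda>n. ?\<delta> n * \<Lambda> (\<xi> - of_int n)) = (\<lambda>N. \<Lambda> \<xi>)" for \<xi>
  proof
    fix N
    have "symm_sum (\<lambda>n. ?\<delta> n * \<Lambda> (\<xi> - of_int n)) N = (\<Sum>n = - int N..int N. if n = 0 then \<Lambda> \<xi> else 0)"
      unfolding symm_sum_def by (rule sum.cong) auto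
    then show "symm_sum (\<lambda>n. ?\<delta> n * \<Lambda> (\<xi> - of_int n)) N = \<Lambda> \<xi>" by simp
  qed
  then have "W ?\<delta> \<Lambda> = \<Lambda>" unfolding W_def by (intro ext limI) (simp only: tendsto_const)
  moreover have "W ?\<delta> \<Lambda> \<in> M_R p"
    using \<Lambda> delta_in_M_Z[OF p] by (auto simp: summability_kernels_def)
  ultimately show ?thesis by (simp add: M_R_def)
qed

text \<open>With a n = \<Lambda>(\<xi> - n), the four series needed by
  \<open>symm_sum_characters_decay\<close> come from s = 0 and s = 1/4, the character \<i>^n, taken
  at \<xi> and at \<xi> + 1, where the terms are a (n - 1).\<close>

lemma kernel_decay:
  assumes conv: "\<And>s. AE \<xi> in lebesgue. convergent (symm_sum (\<lambda>n. cis (2 * pi * s * of_int n) * \<Lambda> (\<xi> - of_int n)))"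
  shows "AE \<xi> in lebesgue. (\<lambda>N. \<Lambda> (\<xi> + real N)) \<longlonglongrightarrow> 0 \<and> (\<lambda>N. \<Lambda> (\<xi> - real N)) \<longlonglongrightarrow> (0 :: complex)"
  using conv[of 0] conv[of "1 / 4"] AE_lebesgue_shift[OF conv[of 0], of 1] AE_lebesgue_shift[OF conv[of "1 / 4"], of 1]
proof eventually_elim
  case (elim \<xi>)
  have shift: "\<xi> + 1 - of_int n = \<xi> - of_int (n - 1)" for n :: int by simp
  have quarter: "2 * pi * (1 / 4) * y = pi / 2 * y" for y :: real by simp
  have zero: "cis (2 * pi * 0 * y) * z = z" for y z by simp
  from symm_sum_characters_decay[of "\<lambda>n. \<Lambda> (\<xi> - of_int n)"] elim
  show ?case unfolding shift quarter zero by simp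
qed

lemma periodization_eq_W:
  assumes "convergent (symm_sum (\<lambda>n. cis (2 * pi * (- x) * of_int n) * \<Lambda> (\<xi> - of_int n)))"
  shows "convergent (symm_sum (\<lambda>n. modulate x \<Lambda> (\<xi> + of_int n)))"
    and "periodization (modulate x \<Lambda>) \<xi> = cis (2 * pi * x * \<xi>) * W (\<lambda>n. cis (2 * pi * (- x) * of_int n)) \<Lambda> \<xi>"
proof -
  have "symm_sum (\<lambda>n. cis (2 * pi * (- x) * of_int n) * \<Lambda> (\<xi> - of_int n)) \<longlonglongrightarrow> W (\<lambda>n. cis (2 * pi * (- x) * of_int n)) \<Lambda> \<xi>"
    using assms unfolding W_def convergent_LIMSEQ_iff .
  then have lim: "symm_sum (\<lambda>n. modulate x \<Lambda> (\<xi> + of_int n)) \<longlonglongrightarrow> cis (2 * pi * x * \<xi>) * W (\<lambda>n. cis (2 * pi * (- x) * of_int n)) \<Lambda> \<xi>"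
    unfolding symm_sum_modulate[abs_def] by (rule tendsto_mult_left)
  then show "convergent (symm_sum (\<lambda>n. modulate x \<Lambda> (\<xi> + of_int n)))" by (rule convergentI)
  show "periodization (modulate x \<Lambda>) \<xi> = cis (2 * pi * x * \<xi>) * W (\<lambda>n. cis (2 * pi * (- x) * of_int n)) \<Lambda> \<xi>"
    unfolding periodization_def using lim by (rule limI)
qed

text \<open>Modulation has modulus 1, so the boundary terms inherit the decay of \<Lambda>.
  Convergence is assumed at \<xi> alone and follows at \<xi> + 1.\<close>

lemma periodization_periodic:
  assumes lim: "(\<lambda>N. \<Lambda> (\<xi> + real N)) \<longlonglongrightarrow> 0" "(\<lambda>N. \<Lambda> (\<xi> - real N)) \<longlonglongrightarrow> 0"
    and conv: "convergent (symm_sum (\<lambda>n. modulate x \<Lambda> (\<xi> + of_int n)))"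
  shows "periodization (modulate x \<Lambda>) (\<xi> + 1) = periodization (modulate x \<Lambda>) \<xi>"
proof -
  let ?g = "modulate x \<Lambda>"
  have "(\<lambda>N. ?g (\<xi> + real (N + 1))) \<longlonglongrightarrow> 0"
    by (rule Lim_null_comparison[OF _ tendsto_norm_zero[OF LIMSEQ_ignore_initial_segment[OF lim(1), of 1]]])
       (simp add: modulate_def norm_mult)
  moreover have "(\<lambda>N. ?g (\<xi> - real N)) \<longlonglongrightarrow> 0"
    by (rule Lim_null_comparison[OF _ tendsto_norm_zero[OF lim(2)]]) (simp add: modulate_def norm_mult)
  ultimately have "(\<lambda>N. ?g (\<xi> + of_int (int N + 1)) - ?g (\<xi> - real N)) \<longlonglongrightarrow> 0 - 0"
    by (intro tendsto_diff) (simp_all add: add_ac)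
  moreover have "symm_sum (\<lambda>n. ?g (\<xi> + of_int n)) \<longlonglongrightarrow> periodization ?g \<xi>"
    using conv unfolding periodization_def convergent_LIMSEQ_iff .
  ultimately have "symm_sum (\<lambda>n. ?g (\<xi> + 1 + of_int n)) \<longlonglongrightarrow> periodization ?g \<xi> + (0 - 0)"
    unfolding symm_sum_shift[abs_def] by (intro tendsto_add)
  then show ?thesis unfolding periodization_def[of _ "\<xi> + 1"] by (intro limI) simp
qed

theorem proposition2p1:
  fixes p :: real
  assumes "1 \<le> p" and "p \<le> 2"
  shows "summability_kernels p \<subseteq> F_class p"
proof
  fix \<Lambda> assume \<Lambda>: "\<Lambda> \<in> summability_kernels p"
  note p = assms(1)
  let ?W = "\<lambda>x. W (\<lambda>n. cis (2 * pi * (- x) * of_int n)) \<Lambda>"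
  define m where "m x = periodization (modulate x \<Lambda>)" for x
  obtain K where K: "0 \<le> K"
    and conv: "\<And>s. AE \<xi> in lebesgue. convergent (symm_sum (\<lambda>n. cis (2 * pi * s * of_int n) * \<Lambda> (\<xi> - of_int n)))"
    and WL: "\<And>s. W (\<lambda>n. cis (2 * pi * s * of_int n)) \<Lambda> \<in> Linfty lebesgue"
    and ext: "\<And>s. \<exists>C\<le>K. extends_with_bound p lebesgue schwartz (mult_op_R (W (\<lambda>n. cis (2 * pi * s * of_int n)) \<Lambda>)) C"
    using kernel_bounds[OF p \<Lambda>] by metis
  have meas: "\<Lambda> \<in> borel_measurable lebesgue" using \<Lambda> by (simp add: summability_kernels_def)
  have m_W: "AE \<xi> in lebesgue. m x \<xi> = cis (2 * pi * x * \<xi>) * ?W x \<xi>" for x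
    using conv[of "- x"] by eventually_elim (simp only: m_def periodization_eq_W)
  have m_conv: "AE \<xi> in lebesgue. convergent (symm_sum (\<lambda>n. modulate x \<Lambda> (\<xi> + of_int n)))" for x
    using conv[of "- x"] by eventually_elim (rule periodization_eq_W)
  have m_L: "m x \<in> Linfty lebesgue" for x
  proof -
    obtain B where "AE \<xi> in lebesgue. cmod (?W x \<xi>) \<le> B"
      using Linfty_lebesgue_bound[OF WL[of "- x"]] by blast
    with m_W[of x] have "AE \<xi> in lebesgue. cmod (m x \<xi>) \<le> B"
      by eventually_elim (simp add: norm_mult)
    then show ?thesis using periodization_measurable[OF meas, of x] by (auto simp: Linfty_def m_def)
  qed
  have m_per: "AE \<xi> in lebesgue. m x (\<xi> + 1) = m x \<xi>" for x
    using kernel_decay[OF conv] m_conv[of x]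
    by eventually_elim (simp add: m_def periodization_periodic)
  \<comment> \<open>The admissible \<open>C\<close> depends on \<open>x\<close>, but all are at most
    \<open>K\<close>; enlarging them to \<open>K\<close> gives a bound uniform in \<open>x\<close>
    and valid for every \<open>x\<close>.\<close>
  have cb: "conv_bound p (mult_coeff (m x)) K" for x
  proof -
    obtain C where C: "C \<le> K" "extends_with_bound p lebesgue schwartz (mult_op_R (?W x)) C"
      using ext[of "- x"] by blast
    have "conv_bound p (mult_coeff (m x)) C"
      by (rule conv_bound_transference[OF p WL[of "- x"] C(2) m_L m_W m_per])
    moreover have "0 \<le> C" using C(2) by (simp add: extends_with_bound_def)
    ultimately show ?thesis using conv_bound_mono[OF p] C(1) by blast
  qed
  have m_T: "m x \<in> M_T p" for x
  proof -
    have "extends_with_bound p (count_space UNIV) finite_seqs (mult_op_Z (m x)) K"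
      using cb K by (simp add: extends_with_bound_mult_op_Z_iff[OF p m_L])
    then show ?thesis using m_L m_per by (auto simp: M_T_def)
  qed
  \<comment> \<open>In this form the norm depends on \<open>x\<close> only through the Fourier
    coefficients of \<open>m x\<close>, whose measurability is known.\<close>
  have norm_eq: "norm_M_T p (m x) = Inf {C. 0 \<le> C \<and> conv_bound p (mult_coeff (m x)) C}" for x
    unfolding norm_M_T_def extension_norm_def extends_with_bound_mult_op_Z_iff[OF p m_L] ..
  have "(\<lambda>x. norm_M_T p (m x)) \<in> Linfty (lebesgue_on {0..<1})"
  proof -
    have "(\<lambda>x. mult_coeff (m x) k) \<in> borel_measurable (lebesgue_on {0..<1})" for k
      unfolding m_def
      by (intro measurable_restrict_space1 measurable_completion)
         (use mult_coeff_periodization_measurable[OF meas] in simp)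
    then have "(\<lambda>x. norm_M_T p (m x)) \<in> borel_measurable (lebesgue_on {0..<1})"
      unfolding norm_eq by (rule borel_measurable_Inf_conv_bound[OF p _ K cb])
    moreover have "norm (norm_M_T p (m x)) \<le> K" for x
    proof -
      have "norm_M_T p (m x) \<le> K"
        unfolding norm_eq using Inf_conv_bound_le_iff[OF p K cb] K cb by blast
      moreover have "0 \<le> norm_M_T p (m x)"
        unfolding norm_eq using K cb by (intro cInf_greatest) auto
      ultimately show ?thesis by simp
    qed
    ultimately show ?thesis by (auto simp: Linfty_def)
  qed
  then show "\<Lambda> \<in> F_class p"
    using kernel_Linfty[OF p \<Lambda>] m_conv m_T by (simp add: F_class_def m_def)
qed

end
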